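(* Let $k>0$ be an integer and let $X$ be a non-singular compact real affine variety of dimension at most $2k-2$. Then the subset $\pi^k_{\mathrm{alg}}(X)$ of algebraic cohomotopy classes is a subgroup of the cohomotopy group $\pi^k(X)$.
   Context: A real affine variety is (up to isomorphism) a real algebraic subset $X\subset\mathbb{R}^a$ with its sheaf of regular functions. A map $f:X\to Y$ between real algebraic sets $X\subset\mathbb{R}^a$, $Y\subset\mathbb{R}^b$ is regular if each of its components can be written as $P/Q$ on $X$, with $P,Q$ real polynomials and $Q$ nowhere vanishing on $X$. Compactness refers to the Euclidean topology. $\mathbb{S}^k\subset\mathbb{R}^{k+1}$ is the standard unit sphere with its usual real algebraic structure, and $e=(1,0,\dots,0)\in\mathbb{S}^k$. $\pi^k(X)$ is the set of (free) homotopy classes of continuous maps $X\to\mathbb{S}^k$. When $X$ is a compact smooth manifold of dimension at most $2k-2$, it is a group (the $k$-th cohomotopy group) as follows. For $f:X\to\mathbb{S}^k$ put $\mathrm{supp}(f)=X\setminus f^{-1}(e)$. Any two classes $\alpha_1,\alpha_2\in\pi^k(X)$ have representatives $f_1,f_2$ with $\mathrm{supp}(f_1)\cap\mathrm{supp}(f_2)=\emptyset$, and $\alpha_1+\alpha_2$ is the class of the map equal to $f_1$ on $\mathrm{supp}(f_1)$, to $f_2$ on $\mathrm{supp}(f_2)$, and to $e$ elsewhere. This is well defined. Under the Pontryagin construction, it corresponds to disjoint union of framed submanifolds of $X$ of codimension $k$. $\pi^k_{\mathrm{alg}}(X)\subset\pi^k(X)$ is the set of classes that have a representative $X\to\mathbb{S}^k$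 which is a regular map. *)

theory Defs
  imports "HOL-Analysis.Analysis" "HOL-Algebra.Group"
begin

section \<open>Real algebraic sets\<close>

definition algebraic_set :: "'a::euclidean_space set \<Rightarrow> bool" where
  "algebraic_set X \<longleftrightarrow>
     (\<exists>F. (\<forall>p\<in>F. real_polynomial_function p) \<and> X = {x. \<forall>p\<in>F. p x = 0})"

definition irreducible_algebraic_set :: "'a::euclidean_space set \<Rightarrow> bool" where
  "irreducible_algebraic_set Z \<longleftrightarrow> algebraic_set Z \<and> Z \<noteq> {} \<and>
     (\<forall>A B. algebraic_set A \<longrightarrow> algebraic_set B \<longrightarrow> Z = A \<union> B \<longrightarrow> Z = A \<or> Z = B)"

text \<open>
  The Krull dimension of \<open>X\<close> with its Zariski topology: the supremum of the lengths \<open>n\<close> of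
  chains \<open>Z\<^sub>0 \<subset> \<dots> \<subset> Z\<^sub>n\<close> of irreducible Zariski closed subsets of \<open>X\<close>.
  The empty set gets dimension \<open>0\<close>, since \<^typ>\<open>enat\<close> has no negative elements.
\<close>

definition alg_dim :: "'a::euclidean_space set \<Rightarrow> enat" where
  "alg_dim X = Sup {enat n | n. \<exists>Z :: nat \<Rightarrow> 'a set.
     (\<forall>i\<le>n. irreducible_algebraic_set (Z i) \<and> Z i \<subseteq> X) \<and> (\<forall>i<n. Z i \<subset> Z (Suc i))}"

text \<open>
  The dimension of the local ring of \<open>X\<close> at \<open>x\<close>, that is, the largest dimension of an
  irreducible component of \<open>X\<close> through \<open>x\<close>.
\<close>

definition local_alg_dim :: "'a::euclidean_space set \<Rightarrow> 'a \<Rightarrow> enat" where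
  "local_alg_dim X x = Sup {alg_dim Z | Z. irreducible_algebraic_set Z \<and> Z \<subseteq> X \<and> x \<in> Z}"

text \<open>
  The Zariski tangent space: the common kernel of the differentials at \<open>x\<close> of all polynomials
  in the vanishing ideal of \<open>X\<close> (not merely of some polynomials that cut out \<open>X\<close>).
\<close>

definition zariski_tangent_space :: "'a::euclidean_space set \<Rightarrow> 'a \<Rightarrow> 'a set" where
  "zariski_tangent_space X x =
     {v. \<forall>p. real_polynomial_function p \<and> (\<forall>y\<in>X. p y = 0) \<longrightarrow>
           frechet_derivative p (at x) v = 0}"

text \<open>
  Every local ring of \<open>X\<close> is regular. Different components of \<open>X\<close> may have different dimensions.
\<close>

definition nonsingular :: "'a::euclidean_space set \<Rightarrow> bool" where
  "nonsingular X \<longleftrightarrow> (\<forall>x\<in>X. enat (dim (zariski_tangent_space X x)) = local_alg_dim X x)"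

text \<open>
  The components of a map into a Euclidean space are its coordinates with respect to the
  standard basis.
\<close>

definition regular_map ::
    "'a::euclidean_space set \<Rightarrow> 'b::euclidean_space set \<Rightarrow> ('a \<Rightarrow> 'b) \<Rightarrow> bool" where
  "regular_map X Y f \<longleftrightarrow> f ` X \<subseteq> Y \<and>
     (\<forall>b\<in>Basis. \<exists>P Q. real_polynomial_function P \<and> real_polynomial_function Q \<and>
        (\<forall>x\<in>X. Q x \<noteq> 0 \<and> f x \<bullet> b = P x / Q x))"

section \<open>Cohomotopy\<close>

text \<open>
  For \<open>k = CARD('k)\<close>, which is positive, \<open>\<real>\<^sup>k\<^sup>+\<^sup>1\<close> is realized as
  \<^typ>\<open>real \<times> (real^'k)\<close>, so that \<open>e = (1, 0, \<dots>, 0)\<close> becomes \<^term>\<open>(1, 0)\<close>.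
\<close>

abbreviation unit_sphere :: "(real \<times> (real^'k)) set" where
  "unit_sphere \<equiv> sphere 0 1"

abbreviation base_pt :: "real \<times> (real^'k)" where
  "base_pt \<equiv> (1, 0)"

text \<open>
  Maps \<open>X \<rightarrow> S\<^sup>k\<close> are represented by functions on the whole ambient type. Their values outside
  \<open>X\<close> are arbitrary: \<open>homotopic_on X\<close> relates any two functions that agree on \<open>X\<close>.
\<close>

type_synonym ('a, 'k) sphere_map = "'a \<Rightarrow> real \<times> (real^'k)"

definition sphere_maps :: "'a::euclidean_space set \<Rightarrow> ('a, 'k::finite) sphere_map set" where
  "sphere_maps X = {f. continuous_on X f \<and> f ` X \<subseteq> unit_sphere}"

definition homotopic_on ::
    "'a::euclidean_space set \<Rightarrow> (('a, 'k::finite) sphere_map \<times> ('a, 'k) sphere_map) set" where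
  "homotopic_on X = {(f, g). homotopic_with_canon (\<lambda>_. True) X unit_sphere f g}"

definition cohomotopy :: "'a::euclidean_space set \<Rightarrow> ('a, 'k::finite) sphere_map set set" where
  "cohomotopy X = sphere_maps X // homotopic_on X"

definition homotopy_class ::
    "'a::euclidean_space set \<Rightarrow> ('a, 'k::finite) sphere_map \<Rightarrow> ('a, 'k) sphere_map set" where
  "homotopy_class X f = homotopic_on X `` {f}"

definition supp_on :: "'a::euclidean_space set \<Rightarrow> ('a, 'k::finite) sphere_map \<Rightarrow> 'a set" where
  "supp_on X f = X - f -` {base_pt}"

definition glue ::
    "'a::euclidean_space set \<Rightarrow> ('a, 'k::finite) sphere_map \<Rightarrow> ('a, 'k) sphere_map
      \<Rightarrow> ('a, 'k) sphere_map" where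
  "glue X f g = (\<lambda>x. if x \<in> supp_on X f then f x else if x \<in> supp_on X g then g x else base_pt)"

text \<open>
  The value of \<open>cohomotopy_add\<close> is only meaningful if representatives with disjoint supports
  exist and all of them yield the same class. This is the case for compact smooth manifolds of
  dimension at most \<open>2k - 2\<close>.
\<close>

definition cohomotopy_add ::
    "'a::euclidean_space set \<Rightarrow> ('a, 'k::finite) sphere_map set \<Rightarrow> ('a, 'k) sphere_map set
      \<Rightarrow> ('a, 'k) sphere_map set" where
  "cohomotopy_add X \<alpha> \<beta> =
     (THE \<gamma>. \<exists>f\<in>\<alpha>. \<exists>g\<in>\<beta>. supp_on X f \<inter> supp_on X g = {} \<and> \<gamma> = homotopy_class X (glue X f g))"

definition cohomotopy_group ::
    "'a::euclidean_space set \<Rightarrow> ('a, 'k::finite) sphere_map set monoid" where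
  "cohomotopy_group X =
     \<lparr>carrier = cohomotopy X, mult = cohomotopy_add X, one = homotopy_class X (\<lambda>_. base_pt)\<rparr>"

definition algebraic_cohomotopy ::
    "'a::euclidean_space set \<Rightarrow> ('a, 'k::finite) sphere_map set set" where
  "algebraic_cohomotopy X = {\<alpha> \<in> cohomotopy X. \<exists>f\<in>\<alpha>. regular_map X unit_sphere f}"

end

theory Submission
  imports Defs
begin

text \<open>
  Vector addition in the stereographic coordinate of \<open>S\<^sup>k\<close> in which the base point is \<open>0\<close> extends to a
  regular map from \<open>S\<^sup>k \<times> S\<^sup>k\<close> minus the single point \<open>(\<infinity>, \<infinity>)\<close> to \<open>S\<^sup>k\<close>, and on the wedge of the two
  spheres it is the folding map. A pair of maps with disjoint supports maps into the wedge, so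
  the cohomotopy sum of two classes is obtained by composing this addition with any pair of
  representatives that avoids \<open>(\<infinity>, \<infinity>)\<close>.

  Such pairs exist, and two of them are connected by homotopies avoiding \<open>(\<infinity>, \<infinity>)\<close>: differentiable
  maps from \<open>X\<close> and \<open>X \<times> [0, 1]\<close> to \<open>\<real>\<^sup>2\<^sup>k\<close> have negligible image, because the tangent spaces of \<open>X\<close> have dimension
  at most \<open>2k - 2\<close>; so a polynomial approximation can be moved off a point by a small
  translation. Associativity and the neutral element are those of vector addition. The reflection
  \<open>(t, y) \<mapsto> (-t, y)\<close>, the inversion \<open>u \<mapsto> u / |u|\<^sup>2\<close> in coordinates, gives inverses, as
  \<open>u + u / |u|\<^sup>2\<close> never vanishes.

  If both maps are regular, they avoid \<open>(\<infinity>, \<infinity>)\<close> after generic translations in the opposite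
  stereographic coordinate, which are regular and homotopic to the identity. Hence
  algebraic classes are closed under addition, and the reflection preserves them.
\<close>

section \<open>Images of sets with small tangent spaces\<close>

text \<open>Continuity is stated jointly in base point and direction because the secant argument
  lets both vary at once. The derivative is built along the generation of polynomials by sums and
  products.\<close>

lemma real_polynomial_function_C1:
  fixes p :: "'a::euclidean_space \<Rightarrow> real"
  assumes "real_polynomial_function p"
  shows "\<exists>p'. (\<forall>x. (p has_derivative p' x) (at x)) \<and> continuous_on UNIV (\<lambda>(x, v). p' x v)"
  using assms
proof induction
  case (linear f)
  have "continuous_on UNIV (\<lambda>z::'a \<times> 'a. f (snd z))"
    by (intro bounded_linear.continuous_on[OF linear] continuous_intros)
  then show ?case
    using linear bounded_linear_imp_has_derivative
    by (intro exI[of _ "\<lambda>x. f"]) (auto simp: case_prod_unfold)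
next
  case (const c)
  then show ?case by (intro exI[of _ "\<lambda>x v. 0"]) (auto simp: case_prod_unfold)
next
  case (add f g)
  then obtain f' g' where
    "\<forall>x. (f has_derivative f' x) (at x)" "continuous_on UNIV (\<lambda>(x, v). f' x v)"
    "\<forall>x. (g has_derivative g' x) (at x)" "continuous_on UNIV (\<lambda>(x, v). g' x v)"
    by blast
  then show ?case
    by (intro exI[of _ "\<lambda>x v. f' x v + g' x v"])
      (auto simp: case_prod_unfold intro!: derivative_intros continuous_intros)
next
  case (mult f g)
  then obtain f' g' where fg:
    "\<forall>x. (f has_derivative f' x) (at x)" "continuous_on UNIV (\<lambda>(x, v). f' x v)"
    "\<forall>x. (g has_derivative g' x) (at x)" "continuous_on UNIV (\<lambda>(x, v). g' x v)"
    by blast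
  have "continuous_on UNIV f" "continuous_on UNIV g"
    using mult.hyps by (auto simp: real_polynomial_function_eq intro: continuous_on_polymonial_function)
  then have "continuous_on UNIV (\<lambda>z::'a \<times> 'a. f (fst z))" "continuous_on UNIV (\<lambda>z::'a \<times> 'a. g (fst z))"
    using continuous_on_compose2[OF _ continuous_on_fst[OF continuous_on_id], of UNIV] by blast+
  with fg show ?case
    by (intro exI[of _ "\<lambda>x v. f x * g' x v + f' x v * g x"])
      (auto simp: case_prod_unfold intro!: has_derivative_mult continuous_intros)
qed

lemma frechet_derivative_linear:
  fixes p :: "'a::euclidean_space \<Rightarrow> real"
  assumes "real_polynomial_function p"
  shows "linear (frechet_derivative p (at x))"
  using assms frechet_derivative_works has_derivative_linear
    differentiable_at_real_polynomial_function by blast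

lemma subspace_zariski_tangent_space: "subspace (zariski_tangent_space X x)"
  unfolding subspace_def zariski_tangent_space_def
  using frechet_derivative_linear[of _ x]
  by (auto simp: linear_0 linear_add linear_scale)

text \<open>
  By compactness of the unit sphere, otherwise there are secants of \<open>K\<close> with both ends tending
  to \<open>x\<close> whose directions converge to a unit vector in the kernel of \<open>L\<close>. By the mean value
  theorem the limit direction is tangent.
\<close>

lemma secant_bound:
  fixes K :: "'a::euclidean_space set" and L :: "'a \<Rightarrow> 'b::euclidean_space"
  assumes L: "linear L" and inj: "\<And>v. v \<in> zariski_tangent_space K x \<Longrightarrow> L v = 0 \<Longrightarrow> v = 0"
  obtains U B where "open U" "x \<in> U" "\<And>y z. y \<in> K \<inter> U \<Longrightarrow> z \<in> K \<inter> U \<Longrightarrow> norm (y - z) \<le> B * norm (L y - L z)"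
proof -
  have "\<exists>n::nat. \<forall>y\<in>K \<inter> ball x (inverse (Suc n)). \<forall>z\<in>K \<inter> ball x (inverse (Suc n)).
      norm (y - z) \<le> real (Suc n) * norm (L y - L z)"
  proof (rule ccontr)
    assume "\<not> ?thesis"
    then have "\<forall>n. \<exists>y z. y \<in> K \<inter> ball x (inverse (Suc n)) \<and> z \<in> K \<inter> ball x (inverse (Suc n)) \<and>
        real (Suc n) * norm (L y - L z) < norm (y - z)"
      by (force simp: not_le)
    then obtain y z where yz: "\<And>n. y n \<in> K \<inter> ball x (inverse (Suc n))" "\<And>n. z n \<in> K \<inter> ball x (inverse (Suc n))"
      "\<And>n. real (Suc n) * norm (L (y n) - L (z n)) < norm (y n - z n)"
      by metis
    define w where "w n = (y n - z n) /\<^sub>R norm (y n - z n)" for n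
    \<comment> \<open>The negated estimate is strict, so the two ends of the secant are distinct and
      \<open>w n\<close> is a genuine unit vector.\<close>
    have pos: "norm (y n - z n) > 0" for n
      using yz(3)[of n] by (smt (verit) mult_nonneg_nonneg norm_ge_zero of_nat_0_le_iff)
    have "w n \<in> sphere 0 1" for n
      using pos[of n] by (simp add: w_def)
    then obtain l r where l: "l \<in> sphere 0 1" and r: "strict_mono r" and lim: "(w \<circ> r) \<longlonglongrightarrow> l"
      using compact_sphere[of "0::'a" 1] unfolding compact_def by metis
    have Lw: "norm (L (w n)) \<le> inverse (Suc n)" for n
    proof -
      have "L (w n) = (L (y n) - L (z n)) /\<^sub>R norm (y n - z n)"
        using L by (simp add: w_def linear_scale linear_diff)
      then have "norm (L (w n)) = norm (L (y n) - L (z n)) / norm (y n - z n)"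
        by (simp add: divide_inverse)
      moreover have "norm (L (y n) - L (z n)) < inverse (Suc n) * norm (y n - z n)"
        using yz(3)[of n] by (simp add: field_simps)
      ultimately show ?thesis
        using pos[of n] by (simp add: pos_divide_le_eq)
    qed
    have "(\<lambda>n. L (w n)) \<longlonglongrightarrow> 0"
      using Lw LIMSEQ_inverse_real_of_nat by (intro Lim_null_comparison[OF _ LIMSEQ_inverse_real_of_nat]) auto
    then have "(\<lambda>n. L (w (r n))) \<longlonglongrightarrow> 0"
      using LIMSEQ_subseq_LIMSEQ[OF _ r] by (fastforce simp: o_def)
    moreover have "(\<lambda>n. L (w (r n))) \<longlonglongrightarrow> L l"
      using linear_continuous_at[OF linear_conv_bounded_linear[THEN iffD1, OF L]] lim
      by (auto simp: o_def intro: isCont_tendsto_compose)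
    ultimately have "L l = 0"
      using LIMSEQ_unique by blast
    moreover have "l \<in> zariski_tangent_space K x"
      unfolding zariski_tangent_space_def
    proof (intro CollectI allI impI, elim conjE)
      fix p :: "'a \<Rightarrow> real"
      assume p: "real_polynomial_function p" "\<forall>y\<in>K. p y = 0"
      obtain p' where p': "\<And>x. (p has_derivative p' x) (at x)"
        and cont: "continuous_on UNIV (\<lambda>(x, v). p' x v)"
        using real_polynomial_function_C1[OF p(1)] by blast
      have "\<exists>\<xi>. dist x \<xi> < inverse (Suc n) \<and> p' \<xi> (w n) = 0" for n
      proof -
        let ?g = "\<lambda>t::real. z n + t *\<^sub>R (y n - z n)"
        have "((p \<circ> ?g) has_derivative (p' (?g t) \<circ> (\<lambda>h. h *\<^sub>R (y n - z n)))) (at t within {0..1})" for t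
          by (intro diff_chain_within has_derivative_at_withinI[OF p'] derivative_eq_intros) auto
        then obtain t where t: "t \<in> {0..1}" "(p \<circ> ?g) 1 - (p \<circ> ?g) 0 = p' (?g t) ((1 - 0) *\<^sub>R (y n - z n))"
          using mvt_very_simple[of 0 1 "p \<circ> ?g" "\<lambda>t. p' (?g t) \<circ> (\<lambda>h. h *\<^sub>R (y n - z n))"] by auto
        \<comment> \<open>The secant may leave \<open>K\<close>, but the ball is convex, so the mean
          value point still tends to \<open>x\<close>.\<close>
        have "?g t \<in> ball x (inverse (Suc n))"
        proof -
          have "?g t = (1 - t) *\<^sub>R z n + t *\<^sub>R y n"
            by (simp add: algebra_simps)
          then show ?thesis
            using convexD_alt[OF convex_ball, of "z n" x "inverse (Suc n)" "y n" t] yz(1,2)[of n] t by auto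
        qed
        moreover have "p' (?g t) (y n - z n) = 0"
          using t p(2) yz(1,2)[of n] by auto
        then have "p' (?g t) (w n) = 0"
          using has_derivative_linear[OF p'[of "?g t"]] by (simp add: w_def linear_scale)
        ultimately show ?thesis
          by (auto simp: mem_ball)
      qed
      then obtain \<xi> where \<xi>: "\<And>n. dist x (\<xi> n) < inverse (Suc n)" "\<And>n. p' (\<xi> n) (w n) = 0"
        by metis
      have "\<xi> \<longlonglongrightarrow> x"
        using \<xi>(1) by (intro metric_tendsto_imp_tendsto[OF LIMSEQ_inverse_real_of_nat])
          (auto simp: dist_commute less_imp_le)
      then have "(\<lambda>n. (\<xi> (r n), w (r n))) \<longlonglongrightarrow> (x, l)"
        using lim LIMSEQ_subseq_LIMSEQ[OF _ r] by (intro tendsto_Pair) (auto simp: o_def)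
      then have "(\<lambda>n. p' (\<xi> (r n)) (w (r n))) \<longlonglongrightarrow> p' x l"
        using continuous_on_tendsto_compose[OF cont] by fastforce
      then have "(\<lambda>n. 0) \<longlonglongrightarrow> p' x l"
        by (simp add: \<xi>(2))
      then have "p' x l = 0"
        by (rule LIMSEQ_unique) (rule tendsto_const)
      then show "frechet_derivative p (at x) l = 0"
        by (simp add: frechet_derivative_at[OF p', symmetric])
    qed
    ultimately have "l = 0"
      using inj by blast
    with l show False by simp
  qed
  then obtain n :: nat where "\<forall>y\<in>K \<inter> ball x (inverse (Suc n)). \<forall>z\<in>K \<inter> ball x (inverse (Suc n)).
      norm (y - z) \<le> real (Suc n) * norm (L y - L z)" ..
  then show ?thesis
    by (intro that[of "ball x (inverse (Suc n))" "real (Suc n)"]) (simp_all del: of_nat_Suc)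
qed

text \<open>A basis of \<open>T\<close> is sent injectively into the standard basis of the target.
  It cannot exhaust that basis, and the extension can be chosen with range the span of these images,
  a proper subspace.\<close>

lemma linear_inj_on_subspace_lowdim:
  fixes T :: "'a::euclidean_space set"
  assumes T: "subspace T" and dim: "dim T < DIM('b::euclidean_space)"
  obtains L :: "'a \<Rightarrow> 'b::euclidean_space" where "linear L" "\<And>v. v \<in> T \<Longrightarrow> L v = 0 \<Longrightarrow> v = 0" "negligible (range L)"
proof -
  obtain C where C: "C \<subseteq> T" "independent C" "T \<subseteq> span C" "card C = dim T"
    using basis_exists by blast
  then have "finite C"
    using independent_imp_finite by blast
  obtain h where h: "h ` C \<subseteq> (Basis::'b set)" "inj_on h C"
    using card_le_inj[OF \<open>finite C\<close> finite_Basis[where 'a='b]] C(4) dim by auto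
  obtain L where L: "linear L" "\<forall>x\<in>C. L x = h x" "range L = span (h ` C)"
    using linear_independent_extend_subspace[OF C(2)] by blast
  have im: "L ` C = h ` C"
    using L(2) by auto
  have "inj_on L (span C)"
  proof (rule linear_inj_on_span_independent_image[OF L(1)])
    show "independent (L ` C)"
      using h(1) im independent_Basis independent_mono by metis
    show "inj_on L C"
      using h(2) L(2) inj_on_cong[of C L h] by simp
  qed
  then have "v = 0" if "v \<in> T" "L v = 0" for v
    using that C(3) L(1) by (metis inj_onD linear_0 span_0 subsetD)
  moreover have "dim (range L) < DIM('b)"
    using L(3) dim dim_le_card'[of "h ` C"] card_image[OF h(2)] C(4) \<open>finite C\<close> by auto
  ultimately show ?thesis
    using that L(1) negligible_lowdim by blast
qed

text \<open>Near each point \<open>\<phi>\<close> factors as \<open>h\<close> after a linear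
  \<open>L\<close> with negligible range, where \<open>L\<close> is injective with Lipschitz inverse
  by \<open>secant_bound\<close>. Differentiability of \<open>\<phi>\<close> makes \<open>h\<close>
  Lipschitz at every point, so \<open>h\<close> keeps the image negligible. Countably many such
  neighbourhoods suffice by the Lindelof property.\<close>

lemma negligible_image_lowdim_tangent:
  fixes \<phi> :: "'a::euclidean_space \<Rightarrow> 'b::euclidean_space"
  assumes dim: "\<And>x. x \<in> S \<Longrightarrow> dim (zariski_tangent_space K x) < DIM('b)"
    and "S \<subseteq> K" and diff: "\<phi> differentiable_on S"
  shows "negligible (\<phi> ` S)"
proof -
  have "\<exists>U. open U \<and> x \<in> U \<and> negligible (\<phi> ` (S \<inter> U))" if xS: "x \<in> S" for x
  proof -
    obtain L :: "'a \<Rightarrow> 'b" where L: "linear L" "\<And>v. v \<in> zariski_tangent_space K x \<Longrightarrow> L v = 0 \<Longrightarrow> v = 0"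
      "negligible (range L)"
      using linear_inj_on_subspace_lowdim[OF subspace_zariski_tangent_space dim[OF xS]] by metis
    obtain U B where U: "open U" "x \<in> U"
      and B: "\<And>y z. y \<in> K \<inter> U \<Longrightarrow> z \<in> K \<inter> U \<Longrightarrow> norm (y - z) \<le> B * norm (L y - L z)"
      using secant_bound[OF L(1,2)] by metis
    \<comment> \<open>Makes the constant positive, so that the radius \<open>d / B'\<close> below
      makes sense.\<close>
    define B' where "B' = max B 1"
    have B': "norm (y - z) \<le> B' * norm (L y - L z)" if "y \<in> S \<inter> U" "z \<in> S \<inter> U" for y z
      using B[of y z] that \<open>S \<subseteq> K\<close> by (smt (verit) B'_def Int_iff mult_right_mono norm_ge_zero subsetD)
    define h where "h = \<phi> \<circ> inv_into (S \<inter> U) L"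
    have inj: "inj_on L (S \<inter> U)"
      using B' by (force intro: inj_onI)
    have hL: "h (L y) = \<phi> y" if "y \<in> S \<inter> U" for y
      using that inj by (simp add: h_def)
    have "negligible (h ` (L ` (S \<inter> U)))"
    proof (rule negligible_locally_Lipschitz_image)
      show "negligible (L ` (S \<inter> U))"
        by (rule negligible_subset[OF L(3)]) auto
      fix u assume "u \<in> L ` (S \<inter> U)"
      then obtain y where y: "y \<in> S \<inter> U" "u = L y" by blast
      obtain \<phi>' where "(\<phi> has_derivative \<phi>') (at y within S)"
        using diff y unfolding differentiable_on_def differentiable_def by blast
      then have bl: "bounded_linear \<phi>'" and "\<forall>e>0. \<exists>d>0. \<forall>z\<in>S. norm (z - y) < d \<longrightarrow>
          norm (\<phi> z - \<phi> y - \<phi>' (z - y)) \<le> e * norm (z - y)"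
        unfolding has_derivative_within_alt by blast+
      \<comment> \<open>The derivative estimate with error constant 1 bounds the increment of
        \<open>\<phi>\<close> at \<open>y\<close> by \<open>1 + M\<close> times the
        displacement.\<close>
      then have "\<exists>d>0. \<forall>z\<in>S. norm (z - y) < d \<longrightarrow>
          norm (\<phi> z - \<phi> y - \<phi>' (z - y)) \<le> 1 * norm (z - y)"
        by (meson zero_less_one)
      then obtain d where d: "d > 0" "\<And>z. z \<in> S \<Longrightarrow> norm (z - y) < d \<Longrightarrow>
          norm (\<phi> z - \<phi> y - \<phi>' (z - y)) \<le> norm (z - y)"
        by auto
      obtain M where M: "M > 0" "\<And>v. norm (\<phi>' v) \<le> norm v * M"
        using bounded_linear.pos_bounded[OF bl] by blast
      have "norm (h v - h u) \<le> (1 + M) * B' * norm (v - u)"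
        if v: "v \<in> L ` (S \<inter> U) \<inter> ball u (d / B')" for v
      proof -
        obtain z where z: "z \<in> S \<inter> U" "v = L z" using v by blast
        have zy: "norm (z - y) \<le> B' * norm (v - u)"
          using B' z y by blast
        also have "\<dots> < d"
          using v by (simp add: dist_norm norm_minus_commute B'_def field_simps)
        finally have "norm (\<phi> z - \<phi> y - \<phi>' (z - y)) \<le> norm (z - y)"
          using d z by auto
        then have "norm (\<phi> z - \<phi> y) \<le> norm (z - y) + norm (\<phi>' (z - y))"
          by (smt (verit) norm_triangle_sub)
        also have "\<dots> \<le> (1 + M) * norm (z - y)"
          using M(2)[of "z - y"] by (simp add: algebra_simps)
        also have "\<dots> \<le> (1 + M) * (B' * norm (v - u))"
          using zy M(1) by (intro mult_left_mono) auto
        finally show ?thesis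
          using hL z y by (simp add: mult.assoc)
      qed
      moreover have "u \<in> ball u (d / B')"
        using d(1) by (simp add: B'_def)
      ultimately show "\<exists>T B. open T \<and> u \<in> T \<and> (\<forall>v\<in>L ` (S \<inter> U) \<inter> T. norm (h v - h u) \<le> B * norm (v - u))"
        using open_ball by blast
    qed simp
    moreover have "h ` (L ` (S \<inter> U)) = \<phi> ` (S \<inter> U)"
      using hL by (simp add: image_image)
    ultimately show ?thesis
      using U by auto
  qed
  then obtain U where U: "\<And>x. x \<in> S \<Longrightarrow> open (U x) \<and> x \<in> U x \<and> negligible (\<phi> ` (S \<inter> U x))"
    by metis
  obtain F where F: "F \<subseteq> U ` S" "countable F" "\<Union>F = \<Union>(U ` S)"
    using Lindelof[of "U ` S"] U by blast
  have "negligible (\<Union>V\<in>F. \<phi> ` (S \<inter> V))"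
    using F U by (intro negligible_countable_Union) auto
  moreover have "\<phi> ` S \<subseteq> (\<Union>V\<in>F. \<phi> ` (S \<inter> V))"
    using U F(3) by (fastforce intro!: image_eqI)
  ultimately show ?thesis
    using negligible_subset by blast
qed

section \<open>Tangent spaces of cylinders and the dimension bound\<close>

lemma frechet_derivative_comp_snd:
  fixes p :: "'a::euclidean_space \<Rightarrow> real"
  assumes "real_polynomial_function p"
  shows "frechet_derivative (p \<circ> snd) (at z) = frechet_derivative p (at (snd z)) \<circ> snd"
proof -
  have "(p has_derivative frechet_derivative p (at (snd z))) (at (snd z))"
    using assms differentiable_at_real_polynomial_function frechet_derivative_works by blast
  then have "((p \<circ> snd) has_derivative frechet_derivative p (at (snd z)) \<circ> snd) (at z)"
    by (intro diff_chain_at) (auto intro: derivative_eq_intros)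
  then show ?thesis
    by (simp add: frechet_derivative_at[symmetric])
qed

text \<open>Polynomials vanishing on \<open>X\<close> pull back along \<open>snd\<close> to ones
  vanishing on the cylinder, so the \<open>X\<close>-component of a tangent vector is tangent to
  \<open>X\<close>. The homotopy parameter contributes the extra 1.\<close>

lemma dim_zariski_tangent_space_cylinder:
  fixes X :: "'a::euclidean_space set"
  shows "dim (zariski_tangent_space (UNIV \<times> X :: (real \<times> 'a) set) z) \<le> Suc (dim (zariski_tangent_space X (snd z)))"
proof -
  have "zariski_tangent_space (UNIV \<times> X :: (real \<times> 'a) set) z \<subseteq> UNIV \<times> zariski_tangent_space X (snd z)"
  proof (clarsimp simp: zariski_tangent_space_def[of X])
    fix t :: real and v :: 'a and p :: "'a \<Rightarrow> real"
    assume tv: "(t, v) \<in> zariski_tangent_space (UNIV \<times> X :: (real \<times> 'a) set) z"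
      and p: "real_polynomial_function p" "\<forall>y\<in>X. p y = 0"
    have "real_polynomial_function (p \<circ> (snd :: real \<times> 'a \<Rightarrow> 'a))"
      using p(1) by (intro real_polynomial_function_compose polynomial_function_bounded_linear bounded_linear_snd)
    then have "frechet_derivative (p \<circ> snd) (at z) (t, v) = 0"
      using tv p(2) unfolding zariski_tangent_space_def by auto
    then show "frechet_derivative p (at (snd z)) v = 0"
      using frechet_derivative_comp_snd[OF p(1), of z] by simp
  qed
  then have "dim (zariski_tangent_space (UNIV \<times> X :: (real \<times> 'a) set) z)
      \<le> dim ((UNIV :: real set) \<times> zariski_tangent_space X (snd z))"
    by (rule dim_subset)
  also have "\<dots> = Suc (dim (zariski_tangent_space X (snd z)))"
    using dim_Times[OF subspace_UNIV subspace_zariski_tangent_space, where 'a=real] by simp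
  finally show ?thesis .
qed

lemma alg_dim_mono: "Y \<subseteq> X \<Longrightarrow> alg_dim Y \<le> alg_dim X"
  unfolding alg_dim_def by (intro Sup_subset_mono) blast

text \<open>Non-singularity turns the tangent dimension into the local dimension, a supremum over
  subvarieties of \<open>X\<close>, each of dimension at most that of \<open>X\<close>.\<close>

lemma dim_zariski_tangent_space_le_alg_dim:
  assumes "nonsingular X" "x \<in> X"
  shows "enat (dim (zariski_tangent_space X x)) \<le> alg_dim X"
proof -
  have "local_alg_dim X x \<le> alg_dim X"
    unfolding local_alg_dim_def by (intro Sup_least) (auto intro: alg_dim_mono)
  with assms show ?thesis
    unfolding nonsingular_def by simp
qed

section \<open>Stereographic addition\<close>

text \<open>If \<open>p\<close> and \<open>q\<close> have finite coordinates u and v, then u + v is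
  \<open>stereo_num p q\<close> divided by \<open>stereo_D p q\<close>, and its squared norm is
  \<open>stereo_E p q / stereo_D p q\<close>. Clearing denominators in
  \<open>stereo_inv (u + v)\<close> yields the formula for \<open>stereo_add\<close>.\<close>

definition stereo_num :: "real \<times> 'v::euclidean_space \<Rightarrow> real \<times> 'v \<Rightarrow> 'v" where
  "stereo_num p q = (1 + fst q) *\<^sub>R snd p + (1 + fst p) *\<^sub>R snd q"

definition stereo_D :: "real \<times> 'v::euclidean_space \<Rightarrow> real \<times> 'v \<Rightarrow> real" where
  "stereo_D p q = (1 + fst p) * (1 + fst q)"

definition stereo_E :: "real \<times> 'v::euclidean_space \<Rightarrow> real \<times> 'v \<Rightarrow> real" where
  "stereo_E p q = 2 - 2 * fst p * fst q + 2 * (snd p \<bullet> snd q)"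

text \<open>
  Vector addition in the stereographic coordinate \<open>y / (1 + t)\<close> of the point \<open>(t, y)\<close> of the
  sphere. The base point has coordinate \<open>0\<close> and its antipode has coordinate \<open>\<infinity>\<close>; only
  \<open>\<infinity> + \<infinity>\<close> is undefined (there both \<open>stereo_D\<close> and \<open>stereo_E\<close> vanish).
\<close>

definition stereo_add :: "real \<times> 'v::euclidean_space \<Rightarrow> real \<times> 'v \<Rightarrow> real \<times> 'v" where
  "stereo_add p q = ((stereo_D p q - stereo_E p q) / (stereo_D p q + stereo_E p q),
     (2 / (stereo_D p q + stereo_E p q)) *\<^sub>R stereo_num p q)"

definition stereo_inv :: "'v::euclidean_space \<Rightarrow> real \<times> 'v" where
  "stereo_inv u = ((1 - u \<bullet> u) / (1 + u \<bullet> u), (2 / (1 + u \<bullet> u)) *\<^sub>R u)"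

abbreviation far_pt :: "real \<times> 'v::euclidean_space" where
  "far_pt \<equiv> (-1, 0)"

lemma in_unit_sphere_iff: "p \<in> sphere 0 1 \<longleftrightarrow> (fst p)\<^sup>2 + snd p \<bullet> snd p = (1::real)"
  for p :: "real \<times> 'v::euclidean_space"
  by (simp add: norm_eq_1 inner_prod_def power2_eq_square)

lemma fst_bounds: "p \<in> sphere 0 1 \<Longrightarrow> -1 \<le> fst p \<and> fst p \<le> (1::real)"
  for p :: "real \<times> 'v::euclidean_space"
  using norm_fst_le[of "fst p" "snd p"] by auto

lemma eq_far_pt_iff: "p \<in> sphere 0 1 \<Longrightarrow> p = far_pt \<longleftrightarrow> fst p = -1"
  for p :: "real \<times> 'v::euclidean_space"
  unfolding in_unit_sphere_iff by (cases p) auto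

lemma eq_base_pt_iff: "p \<in> sphere 0 1 \<Longrightarrow> p = (1, 0) \<longleftrightarrow> fst p = 1"
  for p :: "real \<times> 'v::euclidean_space"
  unfolding in_unit_sphere_iff by (cases p) auto

text \<open>\<open>stereo_E p q\<close> is the squared distance between q and the point obtained
  from p by negating its vector part, and \<open>stereo_D p q\<close> is a product of nonnegative
  factors. If both vanish, p and q have equal first coordinate, which must be -1.\<close>

lemma stereo_denominator_pos:
  fixes p q :: "real \<times> 'v::euclidean_space"
  assumes p: "p \<in> sphere 0 1" and q: "q \<in> sphere 0 1" and "\<not> (p = far_pt \<and> q = far_pt)"
  shows "stereo_D p q + stereo_E p q > 0"
proof -
  let ?p = "(fst p, - snd p)"
  have D: "stereo_D p q \<ge> 0"
    using fst_bounds[OF p] fst_bounds[OF q] by (simp add: stereo_D_def)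
  have np: "norm ?p = 1" "norm q = 1"
    using p q by (auto simp: norm_Pair) (simp add: norm_prod_def)
  have E: "stereo_E p q = (norm (?p - q))\<^sup>2"
    using np unfolding stereo_E_def power2_norm_eq_inner inner_diff norm_eq_1
    by (simp add: inner_commute inner_prod_def algebra_simps)
  moreover have False if "stereo_D p q = 0" "stereo_E p q = 0"
  proof -
    have "?p = q"
      using that(2) E by simp
    moreover have "fst p = -1 \<or> fst q = -1"
      using that(1) by (auto simp: stereo_D_def)
    ultimately have "fst p = -1" "fst q = -1" by auto
    then show False
      using assms eq_far_pt_iff by blast
  qed
  ultimately show ?thesis
    using D by (smt (verit) zero_le_power2)
qed

text \<open>The homogeneous form of |u + v|^2 = E / D. It reduces the sphere equation for
  \<open>stereo_add\<close> to (D - E)^2 + 4 D E = (D + E)^2.\<close>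

lemma stereo_num_inner:
  assumes "p \<in> sphere 0 1" "q \<in> sphere 0 1"
  shows "stereo_num p q \<bullet> stereo_num p q = stereo_D p q * stereo_E p q"
proof -
  have pq: "snd p \<bullet> snd p = 1 - (fst p)\<^sup>2" "snd q \<bullet> snd q = 1 - (fst q)\<^sup>2"
    using assms unfolding in_unit_sphere_iff by linarith+
  show ?thesis
    unfolding stereo_num_def stereo_D_def stereo_E_def inner_add inner_scaleR_left inner_scaleR_right pq
      inner_commute[of "snd q" "snd p"]
    by (simp add: algebra_simps power2_eq_square)
qed

lemma stereo_add_in_sphere:
  fixes p q :: "real \<times> 'v::euclidean_space"
  assumes "p \<in> sphere 0 1" "q \<in> sphere 0 1" "\<not> (p = far_pt \<and> q = far_pt)"
  shows "stereo_add p q \<in> sphere 0 1"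
proof -
  have "((D - E) / (D + E))\<^sup>2 + (2 / (D + E)) * ((2 / (D + E)) * (D * E)) = 1"
    if "D + E > 0" for D E :: real
  proof -
    have "((D - E) / (D + E))\<^sup>2 + (2 / (D + E)) * ((2 / (D + E)) * (D * E))
        = ((D - E)\<^sup>2 + 4 * (D * E)) / (D + E)\<^sup>2"
      by (simp add: power_divide add_divide_distrib power2_eq_square[of "D + E"])
    also have "(D - E)\<^sup>2 + 4 * (D * E) = (D + E)\<^sup>2"
      by (simp add: power2_eq_square algebra_simps)
    finally show ?thesis using that by simp
  qed
  then show ?thesis
    using stereo_denominator_pos[OF assms] stereo_num_inner[OF assms(1,2)]
    unfolding in_unit_sphere_iff stereo_add_def by simp
qed

lemma stereo_inv_in_sphere: "stereo_inv u \<in> sphere 0 1"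
proof -
  have "1 + u \<bullet> u > 0"
    by (simp add: add_pos_nonneg)
  then show ?thesis
    unfolding in_unit_sphere_iff stereo_inv_def by (simp add: divide_simps) (simp add: power2_eq_square algebra_simps)
qed

lemma stereo_inv_surj:
  assumes "p \<in> sphere 0 1" "p \<noteq> far_pt"
  shows "stereo_inv (snd p /\<^sub>R (1 + fst p)) = p"
proof -
  have t: "1 + fst p > 0"
    using assms eq_far_pt_iff[OF assms(1)] fst_bounds[OF assms(1)] by linarith
  have "snd p \<bullet> snd p = (1 - fst p) * (1 + fst p)"
    using assms(1) unfolding in_unit_sphere_iff by (simp add: power2_eq_square algebra_simps)
  then have "(snd p /\<^sub>R (1 + fst p)) \<bullet> (snd p /\<^sub>R (1 + fst p)) = (1 - fst p) / (1 + fst p)"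
    using t by (simp add: divide_simps)
  moreover have "1 + (1 - fst p) / (1 + fst p) = 2 / (1 + fst p)" "1 - (1 - fst p) / (1 + fst p) = 2 * fst p / (1 + fst p)"
    using t by (simp_all add: field_simps)
  ultimately show ?thesis
    using t unfolding stereo_inv_def by (intro prod_eqI) (simp_all add: divide_simps)
qed

text \<open>Views the sphere as a vector space with one point at infinity. Laws of
  \<open>stereo_add\<close> then reduce to laws of vector addition together with absorption at
  infinity.\<close>

lemma stereo_inv_cases:
  assumes "p \<in> sphere 0 1"
  obtains "p = far_pt" | u where "p = stereo_inv u"
  using stereo_inv_surj[OF assms] by metis

lemma stereo_inv_neq_far_pt [simp]: "stereo_inv u \<noteq> far_pt" "far_pt \<noteq> stereo_inv u"
proof -
  have "1 + u \<bullet> u > 0"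
    by (simp add: add_pos_nonneg)
  then show "stereo_inv u \<noteq> far_pt" "far_pt \<noteq> stereo_inv u"
    by (auto simp: stereo_inv_def field_simps)
qed

lemma stereo_inv_0: "stereo_inv 0 = (1, 0)"
  by (simp add: stereo_inv_def)

lemma stereo_inv_inject: "stereo_inv u = stereo_inv v \<longleftrightarrow> u = v"
proof -
  have "snd (stereo_inv u) /\<^sub>R (1 + fst (stereo_inv u)) = u" for u :: 'a
  proof -
    have "1 + u \<bullet> u > 0"
      by (simp add: add_pos_nonneg)
    then show ?thesis
      by (simp add: stereo_inv_def field_simps)
  qed
  then show ?thesis by metis
qed

text \<open>D, E and the numerator share the factor 4 / (A B); what remains is 1, |u + v|^2 and u +
  v respectively. The common factor cancels in both components.\<close>

lemma stereo_add_inv: "stereo_add (stereo_inv u) (stereo_inv v) = stereo_inv (u + v)"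
proof -
  define A where "A = 1 + u \<bullet> u"
  define B where "B = 1 + v \<bullet> v"
  have pos: "A > 0" "B > 0" "1 + (u + v) \<bullet> (u + v) > 0"
    by (simp_all add: A_def B_def add_pos_nonneg)
  have uv: "stereo_inv u = ((2 - A) / A, (2 / A) *\<^sub>R u)" "stereo_inv v = ((2 - B) / B, (2 / B) *\<^sub>R v)"
    by (simp_all add: stereo_inv_def A_def B_def)
  have D: "stereo_D (stereo_inv u) (stereo_inv v) = 4 / (A * B)"
    using pos by (simp add: stereo_D_def uv field_simps)
  have "stereo_E (stereo_inv u) (stereo_inv v) = 4 / (A * B) * (A + B - 2 + 2 * (u \<bullet> v))"
    using pos by (simp add: stereo_E_def uv field_simps)
  also have "A + B - 2 + 2 * (u \<bullet> v) = (u + v) \<bullet> (u + v)"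
    by (simp add: A_def B_def inner_add inner_commute)
  finally have E: "stereo_E (stereo_inv u) (stereo_inv v) = 4 / (A * B) * ((u + v) \<bullet> (u + v))" .
  have N: "stereo_num (stereo_inv u) (stereo_inv v) = (4 / (A * B)) *\<^sub>R (u + v)"
    using pos by (simp add: stereo_num_def uv field_simps scaleR_add_right)
  have quot: "(C - C * s) / (C + C * s) = (1 - s) / (1 + s)" "2 / (C + C * s) * C = 2 / (1 + s)"
    if "C > 0" "1 + s > 0" for C s :: real
  proof -
    have C: "C - C * s = C * (1 - s)" "C + C * s = C * (1 + s)"
      by (simp_all add: algebra_simps)
    have ne: "C \<noteq> 0"
      using that by simp
    show "(C - C * s) / (C + C * s) = (1 - s) / (1 + s)"
      unfolding C by (rule mult_divide_mult_cancel_left[OF ne])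
    show "2 / (C + C * s) * C = 2 / (1 + s)"
      unfolding C times_divide_eq_left mult.commute[of 2 C]
      by (rule mult_divide_mult_cancel_left[OF ne])
  qed
  have "4 / (A * B) > 0"
    using pos(1,2) by simp
  then show ?thesis
    unfolding stereo_add_def stereo_inv_def[of "u + v"] D E N scaleR_scaleR
    by (simp only: quot[OF _ pos(3)])
qed

text \<open>At \<open>far_pt\<close> both D and the numerator vanish, while E = 2 (1 + t), where t
  is the first coordinate of \<open>q\<close>, stays positive.\<close>

lemma stereo_add_far_pt_left:
  assumes "q \<in> sphere 0 1" "q \<noteq> far_pt"
  shows "stereo_add far_pt q = far_pt"
proof -
  have "1 + fst q > 0"
    using assms eq_far_pt_iff fst_bounds by fastforce
  then show ?thesis
    by (simp add: stereo_add_def stereo_D_def stereo_E_def stereo_num_def divide_simps)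
qed

lemma stereo_add_commute: "stereo_add p q = stereo_add q p"
  by (simp add: stereo_add_def stereo_D_def stereo_E_def stereo_num_def inner_commute algebra_simps)

lemma stereo_add_far_pt_right:
  assumes "q \<in> sphere 0 1" "q \<noteq> far_pt"
  shows "stereo_add q far_pt = far_pt"
  using stereo_add_far_pt_left[OF assms] stereo_add_commute by metis

lemma stereo_add_base_pt_left:
  assumes "q \<in> sphere 0 1"
  shows "stereo_add (1, 0) q = q"
  using assms
proof (cases rule: stereo_inv_cases)
  case 1
  then show ?thesis
    using stereo_add_far_pt_right[of "(1, 0)"] by (simp add: norm_Pair)
next
  case (2 u)
  then show ?thesis
    using stereo_add_inv[of 0 u] by (simp add: stereo_inv_0)
qed

lemma stereo_add_base_pt_right: "q \<in> sphere 0 1 \<Longrightarrow> stereo_add q (1, 0) = q"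
  using stereo_add_base_pt_left stereo_add_commute by metis

text \<open>Pairwise exclusion means that at most one of the three points is at infinity. Either all
  are vectors, or both sides are \<open>far_pt\<close>.\<close>

lemma stereo_add_assoc:
  fixes p q r :: "real \<times> 'v::euclidean_space"
  assumes S: "p \<in> sphere 0 1" "q \<in> sphere 0 1" "r \<in> sphere 0 1"
    and "\<not> (p = far_pt \<and> q = far_pt)" "\<not> (p = far_pt \<and> r = far_pt)" "\<not> (q = far_pt \<and> r = far_pt)"
  shows "stereo_add (stereo_add p q) r = stereo_add p (stereo_add q r)"
  by (rule stereo_inv_cases[OF S(1)]; rule stereo_inv_cases[OF S(2)];
      rule stereo_inv_cases[OF S(3)]; insert assms)
    (simp_all add: stereo_add_inv stereo_add_far_pt_left stereo_add_far_pt_right stereo_inv_in_sphere add.assoc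
      del: mem_sphere_0 mem_sphere)

lemma stereo_add_eq_far_pt_iff:
  fixes p q :: "real \<times> 'v::euclidean_space"
  assumes S: "p \<in> sphere 0 1" "q \<in> sphere 0 1" and "\<not> (p = far_pt \<and> q = far_pt)"
  shows "stereo_add p q = far_pt \<longleftrightarrow> p = far_pt \<or> q = far_pt"
  by (rule stereo_inv_cases[OF S(1)]; rule stereo_inv_cases[OF S(2)]; insert assms)
    (simp_all add: stereo_add_inv stereo_add_far_pt_left stereo_add_far_pt_right stereo_inv_in_sphere
      del: mem_sphere_0 mem_sphere)

section \<open>The reflection that provides inverses, and continuity of the addition\<close>

definition flip :: "real \<times> 'v::euclidean_space \<Rightarrow> real \<times> 'v" where
  "flip p = (- fst p, snd p)"

lemma flip_in_sphere: "p \<in> sphere 0 1 \<Longrightarrow> flip p \<in> sphere 0 1"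
  unfolding in_unit_sphere_iff flip_def by simp

lemma flip_flip: "flip (flip p) = p"
  by (simp add: flip_def)

lemma flip_far_pt_iff: "flip p = far_pt \<longleftrightarrow> p = (1, 0)"
  by (cases p) (auto simp: flip_def)

text \<open>For this pair E is constantly 4 and D = 1 - t^2 \<le> 1, so D - E is negative. The sum
  therefore stays in the open hemisphere around \<open>far_pt\<close>.\<close>

lemma fst_stereo_add_flip:
  assumes "p \<in> sphere 0 1"
  shows "fst (stereo_add (flip p) p) < 0"
proof -
  have y: "snd p \<bullet> snd p = 1 - (fst p)\<^sup>2"
    using assms unfolding in_unit_sphere_iff by linarith
  have "stereo_D (flip p) p = 1 - (fst p)\<^sup>2" "stereo_E (flip p) p = 4"
    unfolding stereo_D_def stereo_E_def flip_def by (simp_all add: y) (simp_all add: power2_eq_square algebra_simps)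
  moreover have "(fst p)\<^sup>2 \<le> 1"
    using y inner_ge_zero[of "snd p"] by linarith
  ultimately show ?thesis
    using zero_le_power2[of "fst p"] unfolding stereo_add_def fst_conv by (intro divide_neg_pos) linarith+
qed

lemma continuous_on_stereo_add [continuous_intros]:
  fixes f g :: "'a::topological_space \<Rightarrow> real \<times> 'v::euclidean_space"
  assumes "continuous_on S f" "continuous_on S g"
    "\<And>x. x \<in> S \<Longrightarrow> f x \<in> sphere 0 1" "\<And>x. x \<in> S \<Longrightarrow> g x \<in> sphere 0 1"
    "\<And>x. x \<in> S \<Longrightarrow> \<not> (f x = far_pt \<and> g x = far_pt)"
  shows "continuous_on S (\<lambda>x. stereo_add (f x) (g x))"
proof -
  have "stereo_D (f x) (g x) + stereo_E (f x) (g x) \<noteq> 0" if "x \<in> S" for x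
    using stereo_denominator_pos[of "f x" "g x"] assms(3-5)[OF that] by simp
  then show ?thesis
    using assms(1,2)
    unfolding stereo_add_def stereo_D_def stereo_E_def stereo_num_def
    by (intro continuous_intros) auto
qed

lemma continuous_on_stereo_inv [continuous_intros]:
  assumes "continuous_on S f"
  shows "continuous_on S (\<lambda>x. stereo_inv (f x))"
proof -
  have "1 + u \<bullet> u \<noteq> 0" for u :: 'b
    using inner_ge_zero[of u] by linarith
  then show ?thesis
    using assms unfolding stereo_inv_def by (intro continuous_intros) auto
qed

section \<open>Homotopies of maps to the sphere\<close>

lemma homotopic_on_iff:
  "(f, g) \<in> homotopic_on X \<longleftrightarrow> (\<exists>h. continuous_on ({0..1} \<times> X) h \<and> h ` ({0..1} \<times> X) \<subseteq> sphere 0 1 \<and>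
     (\<forall>x\<in>X. h (0::real, x) = f x) \<and> (\<forall>x\<in>X. h (1, x) = g x))"
proof -
  have "prod_topology (top_of_set {0..1}) (top_of_set X) = top_of_set ({0..1::real} \<times> X)"
    by (simp add: subtopology_Times[symmetric] euclidean_product_topology[symmetric])
  then show ?thesis
    unfolding homotopic_on_def
    by (simp add: homotopic_with image_subset_iff_funcset Pi_iff cong: conj_cong del: mem_sphere_0)
qed

lemma homotopic_onE:
  assumes "(f, g) \<in> homotopic_on X"
  obtains h where "continuous_on ({0..1} \<times> X) h" "\<And>z. z \<in> {0..1} \<times> X \<Longrightarrow> h z \<in> sphere 0 1"
    "\<And>x. x \<in> X \<Longrightarrow> h (0::real, x) = f x" "\<And>x. x \<in> X \<Longrightarrow> h (1, x) = g x"
  using assms unfolding homotopic_on_iff by blast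

lemma homotopic_onI:
  assumes "continuous_on ({0..1} \<times> X) h" "\<And>z. z \<in> {0..1} \<times> X \<Longrightarrow> h z \<in> sphere 0 1"
    "\<And>x. x \<in> X \<Longrightarrow> h (0::real, x) = f x" "\<And>x. x \<in> X \<Longrightarrow> h (1, x) = g x"
  shows "(f, g) \<in> homotopic_on X"
  using assms unfolding homotopic_on_iff by blast

lemma sphere_mapsI:
  assumes "continuous_on X f" "\<And>x. x \<in> X \<Longrightarrow> f x \<in> sphere 0 1"
  shows "f \<in> sphere_maps X"
  using assms by (auto simp: sphere_maps_def)

lemma sphere_mapsD:
  assumes "f \<in> sphere_maps X"
  shows "continuous_on X f" "x \<in> X \<Longrightarrow> f x \<in> sphere 0 1"
  using assms unfolding sphere_maps_def by blast+

lemma homotopic_on_imp_sphere_maps: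
  assumes "(f, g) \<in> homotopic_on X"
  shows "f \<in> sphere_maps X" "g \<in> sphere_maps X"
  using assms homotopic_with_imp_continuous homotopic_with_imp_subset1 homotopic_with_imp_subset2
  unfolding homotopic_on_def sphere_maps_def by blast+

lemma equiv_homotopic_on: "equiv (sphere_maps X) (homotopic_on X)"
proof (rule equivI)
  show "homotopic_on X \<subseteq> sphere_maps X \<times> sphere_maps X"
    using homotopic_on_imp_sphere_maps by auto
  show "refl_on (sphere_maps X) (homotopic_on X)"
    by (rule refl_onI) (auto simp: homotopic_on_def sphere_maps_def)
  show "sym (homotopic_on X)"
    by (rule symI) (auto simp: homotopic_on_def homotopic_with_sym)
  show "trans (homotopic_on X)"
    by (rule transI) (auto simp: homotopic_on_def intro: homotopic_with_trans)
qed

lemma homotopic_on_sym: "(f, g) \<in> homotopic_on X \<Longrightarrow> (g, f) \<in> homotopic_on X"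
  using equiv_homotopic_on by (metis equivE symD)

lemma homotopic_on_refl: "f \<in> sphere_maps X \<Longrightarrow> (f, f) \<in> homotopic_on X"
  using equiv_homotopic_on by (metis equivE refl_onD)

lemma homotopic_on_trans: "(f, g) \<in> homotopic_on X \<Longrightarrow> (g, h) \<in> homotopic_on X \<Longrightarrow> (f, h) \<in> homotopic_on X"
  using equiv_homotopic_on by (metis equivE transD)

lemma homotopic_on_eq:
  assumes "f \<in> sphere_maps X" "\<And>x. x \<in> X \<Longrightarrow> f x = g x"
  shows "(f, g) \<in> homotopic_on X"
proof -
  have "continuous_map (top_of_set X) (top_of_set (sphere 0 1)) f"
    using assms(1) by (auto simp: sphere_maps_def image_subset_iff Pi_iff)
  then show ?thesis
    using assms(2) unfolding homotopic_on_def mem_Collect_eq prod.case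
    by (intro homotopic_with_equal) simp_all
qed

lemma homotopy_class_eq_iff:
  assumes "f \<in> sphere_maps X" "g \<in> sphere_maps X"
  shows "homotopy_class X f = homotopy_class X g \<longleftrightarrow> (f, g) \<in> homotopic_on X"
  using equiv_homotopic_on assms eq_equiv_class_iff unfolding homotopy_class_def by fast

lemma homotopy_class_in_cohomotopy: "f \<in> sphere_maps X \<Longrightarrow> homotopy_class X f \<in> cohomotopy X"
  unfolding homotopy_class_def cohomotopy_def by (rule quotientI)

lemma mem_homotopy_class_iff: "g \<in> homotopy_class X f \<longleftrightarrow> (f, g) \<in> homotopic_on X"
  by (simp add: homotopy_class_def)

lemma cohomotopy_cases:
  assumes "\<alpha> \<in> cohomotopy X"
  obtains f where "f \<in> sphere_maps X" "\<alpha> = homotopy_class X f"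
  using assms unfolding homotopy_class_def cohomotopy_def by (rule quotientE)

section \<open>Homotopies along normalized chords\<close>

lemma dist_sgn_le:
  fixes w p :: "'v::real_normed_vector"
  assumes "norm p = 1"
  shows "dist (sgn w) p \<le> 2 * dist w p"
proof (cases "w = 0")
  case False
  \<comment> \<open>Normalization moves \<open>w\<close> by the difference between its norm and 1,
    which is at most its distance to any unit vector; hence the factor 2.\<close>
  have "sgn w - w = (inverse (norm w) - 1) *\<^sub>R w"
    by (simp add: sgn_div_norm algebra_simps)
  then have "norm (sgn w - w) = \<bar>(inverse (norm w) - 1) * norm w\<bar>"
    by (simp add: abs_mult)
  also have "(inverse (norm w) - 1) * norm w = norm p - norm w"
    using False assms by (simp add: algebra_simps)
  also have "\<bar>norm p - norm w\<bar> \<le> norm (w - p)"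
    by (metis norm_minus_commute norm_triangle_ineq3)
  finally show ?thesis
    using norm_triangle_ineq[of "sgn w - w" "w - p"] by (simp add: dist_norm)
qed (simp add: assms)

text \<open>The chord from \<open>p\<close> to \<open>q\<close>, projected radially to the sphere.
  An explicit formula is kept because the distance of the moving point from \<open>p\<close> has to
  be controlled.\<close>

definition slide :: "'v::real_normed_vector \<Rightarrow> 'v \<Rightarrow> real \<Rightarrow> 'v" where
  "slide p q s = sgn ((1 - s) *\<^sub>R p + s *\<^sub>R q)"

text \<open>A zero on the chord gives its two summands equal norm, forcing the midpoint, and then
  \<open>p\<close> and \<open>q\<close> are antipodal.\<close>

lemma slide_segment_nonzero:
  fixes p q :: "'v::real_normed_vector"
  assumes "norm p = 1" "norm q = 1" "p \<noteq> - q" "s \<in> {0..1}"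
  shows "(1 - s) *\<^sub>R p + s *\<^sub>R q \<noteq> 0"
proof
  assume 0: "(1 - s) *\<^sub>R p + s *\<^sub>R q = 0"
  then have "(1 - s) *\<^sub>R p = - (s *\<^sub>R q)"
    by (rule eq_neg_iff_add_eq_0[THEN iffD2])
  then have "norm ((1 - s) *\<^sub>R p) = norm (s *\<^sub>R q)"
    by simp
  then have s: "s = 1 / 2"
    using assms by simp
  have "(1 / 2) *\<^sub>R (p + q) = 0"
    using 0 unfolding s by (simp add: scaleR_add_right)
  then show False
    using assms(3) by (simp add: eq_neg_iff_add_eq_0)
qed

lemma homotopic_on_slide:
  assumes f: "f \<in> sphere_maps X" and g: "g \<in> sphere_maps X"
    and ne: "\<And>x. x \<in> X \<Longrightarrow> f x \<noteq> - g x"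
  shows "continuous_on ({0..1} \<times> X) (\<lambda>(s, x). slide (f x) (g x) s)"
    and "s \<in> {0..1} \<Longrightarrow> x \<in> X \<Longrightarrow> slide (f x) (g x) s \<in> sphere 0 1"
    and "x \<in> X \<Longrightarrow> slide (f x) (g x) 0 = f x" and "x \<in> X \<Longrightarrow> slide (f x) (g x) 1 = g x"
    and "(f, g) \<in> homotopic_on X"
proof -
  have nz: "(1 - s) *\<^sub>R f x + s *\<^sub>R g x \<noteq> 0" if "s \<in> {0..1}" "x \<in> X" for s x
    using slide_segment_nonzero[OF _ _ ne[OF that(2)] that(1)] sphere_mapsD(2)[OF f that(2)] sphere_mapsD(2)[OF g that(2)]
    by simp
  have fg: "continuous_on ({0..1::real} \<times> X) (\<lambda>z. f (snd z))" "continuous_on ({0..1::real} \<times> X) (\<lambda>z. g (snd z))"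
    by (rule continuous_on_compose2[OF sphere_mapsD(1)[OF f] continuous_on_snd[OF continuous_on_id]], force)
      (rule continuous_on_compose2[OF sphere_mapsD(1)[OF g] continuous_on_snd[OF continuous_on_id]], force)
  show cont: "continuous_on ({0..1} \<times> X) (\<lambda>(s, x). slide (f x) (g x) s)"
    unfolding slide_def case_prod_unfold using nz
    by (intro continuous_on_sgn continuous_intros fg) auto
  show S: "slide (f x) (g x) s \<in> sphere 0 1" if "s \<in> {0..1}" "x \<in> X" for s x
    using nz[OF that] by (simp add: slide_def norm_sgn)
  show 0: "slide (f x) (g x) 0 = f x" if "x \<in> X" for x
    using sphere_mapsD(2)[OF f that] by (simp add: slide_def sgn_div_norm)
  show 1: "slide (f x) (g x) 1 = g x" if "x \<in> X" for x
    using sphere_mapsD(2)[OF g that] by (simp add: slide_def sgn_div_norm)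
  show "(f, g) \<in> homotopic_on X"
    by (rule homotopic_onI[OF cont]) (use S 0 1 in \<open>auto simp del: mem_sphere_0\<close>)
qed

lemma dist_slide_le:
  fixes p q :: "'v::real_normed_vector"
  assumes "norm p = 1" "s \<in> {0..1}"
  shows "dist (slide p q s) p \<le> 2 * dist p q"
proof -
  have "(1 - s) *\<^sub>R p + s *\<^sub>R q - p = s *\<^sub>R (q - p)"
    by (simp add: algebra_simps)
  then have "dist ((1 - s) *\<^sub>R p + s *\<^sub>R q) p = s * dist p q"
    using assms(2) by (simp add: dist_norm norm_minus_commute)
  also have "\<dots> \<le> 1 * dist p q"
    using assms(2) by (intro mult_right_mono) auto
  finally show ?thesis
    using dist_sgn_le[OF assms(1), of "(1 - s) *\<^sub>R p + s *\<^sub>R q"] by (simp add: slide_def)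
qed

section \<open>Pairs of maps with a pointwise sum\<close>

definition addable :: "'a set \<Rightarrow> ('a \<Rightarrow> real \<times> 'v::euclidean_space) \<Rightarrow> ('a \<Rightarrow> real \<times> 'v) \<Rightarrow> bool" where
  "addable X f g \<longleftrightarrow> (\<forall>x\<in>X. \<not> (f x = far_pt \<and> g x = far_pt))"

definition pointwise_add :: "('a \<Rightarrow> real \<times> 'v::euclidean_space) \<Rightarrow> ('a \<Rightarrow> real \<times> 'v) \<Rightarrow> 'a \<Rightarrow> real \<times> 'v" where
  "pointwise_add f g = (\<lambda>x. stereo_add (f x) (g x))"

lemma addableD: "addable X f g \<Longrightarrow> x \<in> X \<Longrightarrow> \<not> (f x = far_pt \<and> g x = far_pt)"
  by (auto simp: addable_def)

lemma pointwise_add_in_sphere_maps: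
  assumes "f \<in> sphere_maps X" "g \<in> sphere_maps X" "addable X f g"
  shows "pointwise_add f g \<in> sphere_maps X"
  unfolding pointwise_add_def
  using sphere_mapsD[OF assms(1)] sphere_mapsD[OF assms(2)] addableD[OF assms(3)]
  by (intro sphere_mapsI continuous_on_stereo_add stereo_add_in_sphere) blast+

lemma pointwise_add_homotopic:
  assumes F: "continuous_on ({0..1} \<times> X) F" "\<And>z. z \<in> {0..1} \<times> X \<Longrightarrow> F z \<in> sphere 0 1"
    and G: "continuous_on ({0..1} \<times> X) G" "\<And>z. z \<in> {0..1} \<times> X \<Longrightarrow> G z \<in> sphere 0 1"
    and "addable ({0..1} \<times> X) F G"
  shows "(pointwise_add (\<lambda>x. F (0::real, x)) (\<lambda>x. G (0, x)), pointwise_add (\<lambda>x. F (1, x)) (\<lambda>x. G (1, x))) \<in> homotopic_on X"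
proof (rule homotopic_onI)
  show "continuous_on ({0..1} \<times> X) (\<lambda>z. stereo_add (F z) (G z))"
    using F G addableD[OF assms(5)] by (intro continuous_on_stereo_add) blast+
  show "stereo_add (F z) (G z) \<in> sphere 0 1" if "z \<in> {0..1} \<times> X" for z
    using F(2)[OF that] G(2)[OF that] addableD[OF assms(5) that] by (rule stereo_add_in_sphere)
qed (simp_all add: pointwise_add_def)

text \<open>By compactness the sum of the two distances to \<open>far_pt\<close> has a positive
  lower bound. Sliding to nearby maps moves each value only a little, so the pair stays addable
  throughout and the pointwise sums are homotopic.\<close>

lemma addable_open:
  fixes f g :: "'a::euclidean_space \<Rightarrow> real \<times> (real^'k)"
  assumes X: "compact X" and f: "f \<in> sphere_maps X" and g: "g \<in> sphere_maps X" and "addable X f g"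
  obtains \<delta> where "\<delta> > 0" "\<And>f' g'. f' \<in> sphere_maps X \<Longrightarrow> g' \<in> sphere_maps X \<Longrightarrow>
     (\<And>x. x \<in> X \<Longrightarrow> dist (f x) (f' x) < \<delta>) \<Longrightarrow> (\<And>x. x \<in> X \<Longrightarrow> dist (g x) (g' x) < \<delta>) \<Longrightarrow>
     addable X f' g' \<and> (pointwise_add f g, pointwise_add f' g') \<in> homotopic_on X"
proof -
  let ?m = "\<lambda>x. dist (f x) far_pt + dist (g x) far_pt"
  have m: "continuous_on X ?m"
    by (intro continuous_intros sphere_mapsD f g)
  have pos: "?m x > 0" if "x \<in> X" for x
    using addableD[OF assms(4) that] by (smt (verit) zero_le_dist zero_less_dist_iff)
  obtain \<epsilon> where \<epsilon>: "\<epsilon> > 0" "\<And>x. x \<in> X \<Longrightarrow> ?m x \<ge> \<epsilon>"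
  proof (cases "X = {}")
    case True
    then show ?thesis using that[of 1] by simp
  next
    case False
    then obtain x where "x \<in> X" "\<forall>y\<in>X. ?m x \<le> ?m y"
      using continuous_attains_inf[OF X False m] by blast
    then show ?thesis using that[of "?m x"] pos by blast
  qed
  \<comment> \<open>A slide moves each value by at most 2\<delta>, so a collision at infinity would
    give \<epsilon> \<le> 4\<delta>, less than 8\<delta>. The bound \<delta> \<le> 1 excludes
    antipodal values, whose distance is 2.\<close>
  define \<delta> where "\<delta> = min 1 (\<epsilon> / 8)"
  have \<delta>: "\<delta> > 0" "\<delta> \<le> 1" "8 * \<delta> \<le> \<epsilon>"
    using \<epsilon>(1) by (auto simp: \<delta>_def)
  show ?thesis
  proof (rule that[OF \<delta>(1)])
    fix f' g' :: "'a \<Rightarrow> real \<times> (real^'k)"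
    assume f': "f' \<in> sphere_maps X" and g': "g' \<in> sphere_maps X"
      and near: "\<And>x. x \<in> X \<Longrightarrow> dist (f x) (f' x) < \<delta>" "\<And>x. x \<in> X \<Longrightarrow> dist (g x) (g' x) < \<delta>"
    have na: "p x \<noteq> - q x" if "p \<in> sphere_maps X" "x \<in> X" "dist (p x) (q x) < \<delta>" for p q :: "'a \<Rightarrow> real \<times> (real^'k)" and x
    proof
      assume *: "p x = - q x"
      have "norm (p x) = 1"
        using sphere_mapsD(2)[OF that(1,2)] by simp
      moreover have "dist (p x) (q x) = 2 * norm (p x)"
      proof -
        have "p x - q x = - (2 *\<^sub>R q x)"
          by (simp add: * scaleR_2)
        then show ?thesis by (simp add: * dist_norm)
      qed
      ultimately show False using that(3) \<delta>(2) by linarith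
    qed
    have "f x \<noteq> - f' x" "g x \<noteq> - g' x" if "x \<in> X" for x
      using na f g near that by blast+
    note sf = homotopic_on_slide[OF f f' this(1)] and sg = homotopic_on_slide[OF g g' this(2)]
    let ?F = "\<lambda>(s, x). slide (f x) (f' x) s" and ?G = "\<lambda>(s, x). slide (g x) (g' x) s"
    have ad: "addable ({0..1} \<times> X) ?F ?G"
      unfolding addable_def
    proof (intro ballI notI)
      fix z assume z: "z \<in> {0..1::real} \<times> X" and far: "?F z = far_pt \<and> ?G z = far_pt"
      obtain s x where sx: "z = (s, x)" "s \<in> {0..1}" "x \<in> X" using z by blast
      have "dist (slide (f x) (f' x) s) (f x) \<le> 2 * dist (f x) (f' x)"
        "dist (slide (g x) (g' x) s) (g x) \<le> 2 * dist (g x) (g' x)"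
        using sphere_mapsD(2)[OF f sx(3)] sphere_mapsD(2)[OF g sx(3)] sx(2) by (auto intro!: dist_slide_le)
      then have "dist (f x) far_pt \<le> 2 * \<delta>" "dist (g x) far_pt \<le> 2 * \<delta>"
        using far near[OF sx(3)] unfolding sx(1) by (auto simp: dist_commute)
      then show False
        using \<epsilon>(2)[OF sx(3)] \<epsilon>(1) \<delta> by linarith
    qed
    have "addable X f' g'"
      unfolding addable_def
    proof
      fix x assume "x \<in> X"
      then show "\<not> (f' x = far_pt \<and> g' x = far_pt)"
        using addableD[OF ad, of "(1, x)"] sf(4) sg(4) by simp
    qed
    moreover have "(pointwise_add f g, pointwise_add f' g') \<in> homotopic_on X"
    proof -
      have "(pointwise_add (\<lambda>x. ?F (0::real, x)) (\<lambda>x. ?G (0, x)), pointwise_add (\<lambda>x. ?F (1, x)) (\<lambda>x. ?G (1, x))) \<in> homotopic_on X"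
        using sf(2) sg(2) by (intro pointwise_add_homotopic[OF sf(1) _ sg(1) _ ad]) (auto simp del: mem_sphere_0)
      moreover have "(pointwise_add f g, pointwise_add (\<lambda>x. ?F (0::real, x)) (\<lambda>x. ?G (0, x))) \<in> homotopic_on X"
        using sf(3) sg(3) by (intro homotopic_on_eq pointwise_add_in_sphere_maps f g assms(4)) (auto simp: pointwise_add_def)
      moreover have "(pointwise_add f' g', pointwise_add (\<lambda>x. ?F (1::real, x)) (\<lambda>x. ?G (1, x))) \<in> homotopic_on X"
        using sf(4) sg(4) \<open>addable X f' g'\<close> by (intro homotopic_on_eq pointwise_add_in_sphere_maps f' g') (auto simp: pointwise_add_def)
      ultimately show ?thesis
        by (meson homotopic_on_trans homotopic_on_sym)
    qed
    ultimately show "addable X f' g' \<and> (pointwise_add f g, pointwise_add f' g') \<in> homotopic_on X" ..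
  qed
qed

section \<open>Regular maps\<close>

text \<open>Separates the quotient condition of \<open>regular_map\<close> from its target, so that
  it applies to numerators, denominators and the other pieces of a formula.\<close>

definition regular_on :: "'a::euclidean_space set \<Rightarrow> ('a \<Rightarrow> 'b::euclidean_space) \<Rightarrow> bool" where
  "regular_on X f \<longleftrightarrow> (\<forall>b\<in>Basis. \<exists>P Q. real_polynomial_function P \<and> real_polynomial_function Q \<and>
     (\<forall>x\<in>X. Q x \<noteq> 0 \<and> f x \<bullet> b = P x / Q x))"

lemma regular_map_iff: "regular_map X Y f \<longleftrightarrow> f ` X \<subseteq> Y \<and> regular_on X f"
  unfolding regular_map_def regular_on_def ..

lemma regular_on_realE:
  fixes f :: "'a::euclidean_space \<Rightarrow> real"
  assumes "regular_on X f"
  obtains P Q where "real_polynomial_function P" "real_polynomial_function Q"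
    "\<And>x. x \<in> X \<Longrightarrow> Q x \<noteq> 0" "\<And>x. x \<in> X \<Longrightarrow> f x = P x / Q x"
  using assms unfolding regular_on_def by auto

lemma regular_on_realI:
  fixes f :: "'a::euclidean_space \<Rightarrow> real"
  assumes "real_polynomial_function P" "real_polynomial_function Q"
    "\<And>x. x \<in> X \<Longrightarrow> Q x \<noteq> 0" "\<And>x. x \<in> X \<Longrightarrow> f x = P x / Q x"
  shows "regular_on X f"
  using assms unfolding regular_on_def by auto

lemma regular_on_componentwise: "regular_on X f \<longleftrightarrow> (\<forall>b\<in>Basis. regular_on X (\<lambda>x. f x \<bullet> b))"
  unfolding regular_on_def by simp

lemma regular_on_subset: "regular_on X f \<Longrightarrow> S \<subseteq> X \<Longrightarrow> regular_on S f"
  unfolding regular_on_def by (meson subsetD)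

lemma regular_on_const: "regular_on X (\<lambda>x. c)"
  unfolding regular_on_def
proof
  fix b :: 'b
  show "\<exists>P Q. real_polynomial_function P \<and> real_polynomial_function Q \<and> (\<forall>x\<in>X. Q x \<noteq> 0 \<and> c \<bullet> b = P x / Q x)"
    by (intro exI[of _ "\<lambda>x. c \<bullet> b"] exI[of _ "\<lambda>x. 1"]) (simp add: real_polynomial_function_eq)
qed

lemma regular_on_mult:
  fixes f g :: "'a::euclidean_space \<Rightarrow> real"
  assumes "regular_on X f" "regular_on X g"
  shows "regular_on X (\<lambda>x. f x * g x)"
proof -
  obtain P Q where PQ: "real_polynomial_function P" "real_polynomial_function Q"
    "\<And>x. x \<in> X \<Longrightarrow> Q x \<noteq> 0" "\<And>x. x \<in> X \<Longrightarrow> f x = P x / Q x"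
    using regular_on_realE[OF assms(1)] by metis
  obtain R S where RS: "real_polynomial_function R" "real_polynomial_function S"
    "\<And>x. x \<in> X \<Longrightarrow> S x \<noteq> 0" "\<And>x. x \<in> X \<Longrightarrow> g x = R x / S x"
    using regular_on_realE[OF assms(2)] by metis
  show ?thesis
    by (rule regular_on_realI[of "\<lambda>x. P x * R x" "\<lambda>x. Q x * S x"]) (use PQ RS in auto)
qed

lemma regular_on_inverse:
  fixes f :: "'a::euclidean_space \<Rightarrow> real"
  assumes "regular_on X f" "\<And>x. x \<in> X \<Longrightarrow> f x \<noteq> 0"
  shows "regular_on X (\<lambda>x. inverse (f x))"
proof -
  obtain P Q where PQ: "real_polynomial_function P" "real_polynomial_function Q"
    "\<And>x. x \<in> X \<Longrightarrow> Q x \<noteq> 0" "\<And>x. x \<in> X \<Longrightarrow> f x = P x / Q x"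
    using regular_on_realE[OF assms(1)] by metis
  show ?thesis
    by (rule regular_on_realI[of Q P]) (use PQ assms(2) in auto)
qed

lemma regular_on_add:
  assumes "regular_on X f" "regular_on X g"
  shows "regular_on X (\<lambda>x. f x + g x)"
  unfolding regular_on_componentwise[of X "\<lambda>x. f x + g x"]
proof
  fix b :: 'b assume b: "b \<in> Basis"
  obtain P Q where PQ: "real_polynomial_function P" "real_polynomial_function Q"
    "\<And>x. x \<in> X \<Longrightarrow> Q x \<noteq> 0" "\<And>x. x \<in> X \<Longrightarrow> f x \<bullet> b = P x / Q x"
    using assms(1) b unfolding regular_on_def by metis
  obtain R S where RS: "real_polynomial_function R" "real_polynomial_function S"
    "\<And>x. x \<in> X \<Longrightarrow> S x \<noteq> 0" "\<And>x. x \<in> X \<Longrightarrow> g x \<bullet> b = R x / S x"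
    using assms(2) b unfolding regular_on_def by metis
  show "regular_on X (\<lambda>x. (f x + g x) \<bullet> b)"
    by (rule regular_on_realI[of "\<lambda>x. P x * S x + R x * Q x" "\<lambda>x. Q x * S x"])
      (use PQ RS in \<open>auto simp: inner_add_left add_frac_eq\<close>)
qed

lemma regular_on_scaleR:
  assumes "regular_on X r" "regular_on X f"
  shows "regular_on X (\<lambda>x. r x *\<^sub>R f x)"
  unfolding regular_on_componentwise[of X "\<lambda>x. r x *\<^sub>R f x"] inner_scaleR_left
  using regular_on_mult[OF assms(1)] regular_on_componentwise[THEN iffD1, OF assms(2)] by blast

lemma regular_on_minus: "regular_on X f \<Longrightarrow> regular_on X (\<lambda>x. - f x)"
  using regular_on_scaleR[OF regular_on_const, of X f "-1"] by simp

lemma regular_on_diff: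
  assumes "regular_on X f" "regular_on X g"
  shows "regular_on X (\<lambda>x. f x - g x)"
  using regular_on_add[OF assms(1) regular_on_minus[OF assms(2)]] by simp

lemma regular_on_divide:
  fixes f g :: "'a::euclidean_space \<Rightarrow> real"
  assumes "regular_on X f" "regular_on X g" "\<And>x. x \<in> X \<Longrightarrow> g x \<noteq> 0"
  shows "regular_on X (\<lambda>x. f x / g x)"
  unfolding divide_inverse by (intro regular_on_mult regular_on_inverse assms)

lemma regular_on_sum:
  fixes f :: "'i \<Rightarrow> 'a::euclidean_space \<Rightarrow> 'b::euclidean_space"
  assumes "finite I" "\<And>i. i \<in> I \<Longrightarrow> regular_on X (f i)"
  shows "regular_on X (\<lambda>x. \<Sum>i\<in>I. f i x)"
  using assms by (induction I) (auto intro: regular_on_const regular_on_add)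

lemma regular_on_inner:
  assumes "regular_on X f" "regular_on X g"
  shows "regular_on X (\<lambda>x. f x \<bullet> g x)"
proof -
  have "regular_on X (\<lambda>x. \<Sum>b\<in>Basis. (f x \<bullet> b) * (g x \<bullet> b))"
    by (intro regular_on_sum regular_on_mult regular_on_componentwise[THEN iffD1, OF assms(1), rule_format]
        regular_on_componentwise[THEN iffD1, OF assms(2), rule_format] finite_Basis)
  moreover have "(\<lambda>x. f x \<bullet> g x) = (\<lambda>x. \<Sum>b\<in>Basis. (f x \<bullet> b) * (g x \<bullet> b))"
    using euclidean_inner by blast
  ultimately show ?thesis by simp
qed

lemma regular_on_Pair:
  assumes "regular_on X f" "regular_on X g"
  shows "regular_on X (\<lambda>x. (f x, g x))"
  unfolding regular_on_componentwise[of X "\<lambda>x. (f x, g x)"]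
proof
  fix b :: "'b \<times> 'c" assume "b \<in> Basis"
  then consider c where "c \<in> Basis" "b = (c, 0)" | c where "c \<in> Basis" "b = (0, c)"
    by (auto simp: Basis_prod_def)
  then show "regular_on X (\<lambda>x. (f x, g x) \<bullet> b)"
  proof cases
    case (1 c)
    then show ?thesis
      using regular_on_componentwise[THEN iffD1, OF assms(1), rule_format, of c] by simp
  next
    case (2 c)
    then show ?thesis
      using regular_on_componentwise[THEN iffD1, OF assms(2), rule_format, of c] by simp
  qed
qed

lemma regular_on_fst:
  assumes "regular_on X f"
  shows "regular_on X (\<lambda>x. fst (f x))"
  unfolding regular_on_componentwise[of X "\<lambda>x. fst (f x)"]
proof
  fix b :: 'b assume "b \<in> Basis"
  then have "(b, 0) \<in> Basis"
    by (simp add: Basis_prod_def)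
  then have "regular_on X (\<lambda>x. f x \<bullet> (b, 0))"
    by (rule regular_on_componentwise[THEN iffD1, OF assms, rule_format])
  then show "regular_on X (\<lambda>x. fst (f x) \<bullet> b)"
    by (simp add: inner_prod_def)
qed

lemma regular_on_snd:
  assumes "regular_on X f"
  shows "regular_on X (\<lambda>x. snd (f x))"
  unfolding regular_on_componentwise[of X "\<lambda>x. snd (f x)"]
proof
  fix b :: 'c assume "b \<in> Basis"
  then have "(0, b) \<in> Basis"
    by (simp add: Basis_prod_def)
  then have "regular_on X (\<lambda>x. f x \<bullet> (0, b))"
    by (rule regular_on_componentwise[THEN iffD1, OF assms, rule_format])
  then show "regular_on X (\<lambda>x. snd (f x) \<bullet> b)"
    by (simp add: inner_prod_def)
qed

lemmas regular_on_intros = regular_on_const regular_on_mult regular_on_inverse regular_on_add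
  regular_on_scaleR regular_on_minus regular_on_diff regular_on_divide regular_on_inner
  regular_on_Pair regular_on_fst regular_on_snd

lemma regular_on_imp_differentiable_on:
  assumes "regular_on X f"
  shows "f differentiable_on X"
  unfolding differentiable_on_def
proof
  fix x assume x: "x \<in> X"
  have "(\<lambda>y. f y \<bullet> b) differentiable (at x within X)" if b: "b \<in> Basis" for b
  proof -
    obtain P Q where PQ: "real_polynomial_function P" "real_polynomial_function Q"
      "\<And>x. x \<in> X \<Longrightarrow> Q x \<noteq> 0" "\<And>x. x \<in> X \<Longrightarrow> f x \<bullet> b = P x / Q x"
      using assms b unfolding regular_on_def by metis
    have "(\<lambda>y. P y / Q y) differentiable (at x within X)"
      using PQ(1-3) x by (intro differentiable_divide differentiable_at_real_polynomial_function) auto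
    then show ?thesis
      by (rule differentiable_transform_within[OF _ zero_less_one x]) (simp add: PQ(4))
  qed
  then show "f differentiable (at x within X)"
    using differentiable_componentwise_within by blast
qed

lemma regular_on_stereo_add:
  fixes f g :: "'a::euclidean_space \<Rightarrow> real \<times> 'v::euclidean_space"
  assumes "regular_on X f" "regular_on X g"
    "\<And>x. x \<in> X \<Longrightarrow> f x \<in> sphere 0 1" "\<And>x. x \<in> X \<Longrightarrow> g x \<in> sphere 0 1" "addable X f g"
  shows "regular_on X (\<lambda>x. stereo_add (f x) (g x))"
proof -
  have "stereo_D (f x) (g x) + stereo_E (f x) (g x) \<noteq> 0" if "x \<in> X" for x
    using stereo_denominator_pos[of "f x" "g x"] assms(3,4)[OF that] addableD[OF assms(5) that] by simp
  moreover have "regular_on X (\<lambda>x. stereo_D (f x) (g x))" "regular_on X (\<lambda>x. stereo_E (f x) (g x))"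
    "regular_on X (\<lambda>x. stereo_num (f x) (g x))"
    unfolding stereo_D_def stereo_E_def stereo_num_def by (intro regular_on_intros assms(1,2))+
  ultimately show ?thesis
    unfolding stereo_add_def by (intro regular_on_intros)
qed

lemma regular_on_flip: "regular_on X f \<Longrightarrow> regular_on X (\<lambda>x. flip (f x))"
  unfolding flip_def by (intro regular_on_intros)

text \<open>
  Translation in the coordinate \<open>y / (1 - t)\<close>, for which the far point is \<open>0\<close>.
\<close>

definition translate :: "'v::euclidean_space \<Rightarrow> real \<times> 'v \<Rightarrow> real \<times> 'v" where
  "translate u p = flip (stereo_add (flip p) (stereo_inv u))"

lemma translate_in_sphere: "p \<in> sphere 0 1 \<Longrightarrow> translate u p \<in> sphere 0 1"
  unfolding translate_def
  by (intro flip_in_sphere stereo_add_in_sphere stereo_inv_in_sphere) simp_all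

lemma translate_0: "p \<in> sphere 0 1 \<Longrightarrow> translate 0 p = p"
  unfolding translate_def stereo_inv_0
  by (simp add: stereo_add_base_pt_right flip_in_sphere flip_flip del: mem_sphere_0 mem_sphere)

text \<open>In the opposite coordinate \<open>far_pt\<close> is the origin and the base point is
  infinity. Translation fixes infinity, and it carries a finite point to the origin only if the
  point is the negative of \<open>u\<close>.\<close>

lemma translate_eq_far_pt:
  assumes p: "p \<in> sphere 0 1" and far: "translate u p = far_pt"
  shows "p \<noteq> (1, 0)" "u = - (snd p /\<^sub>R (1 - fst p))"
proof -
  have *: "stereo_add (flip p) (stereo_inv u) = (1, 0)"
    using far unfolding translate_def flip_far_pt_iff .
  show ne: "p \<noteq> (1, 0)"
  proof
    assume "p = (1, 0)"
    then have "flip p = far_pt"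
      by (simp add: flip_def)
    then show False
      using * stereo_add_far_pt_left[OF stereo_inv_in_sphere, of u] by simp
  qed
  have "stereo_inv (snd (flip p) /\<^sub>R (1 + fst (flip p))) = flip p"
    using ne by (intro stereo_inv_surj flip_in_sphere p) (simp add: flip_far_pt_iff)
  then have "stereo_inv (snd (flip p) /\<^sub>R (1 + fst (flip p)) + u) = stereo_inv 0"
    using * stereo_add_inv stereo_inv_0 by metis
  then have "snd (flip p) /\<^sub>R (1 + fst (flip p)) + u = 0"
    unfolding stereo_inv_inject .
  then show "u = - (snd p /\<^sub>R (1 - fst p))"
    by (simp add: flip_def add_eq_0_iff)
qed

lemma regular_on_translate:
  assumes "regular_on X f" "\<And>x. x \<in> X \<Longrightarrow> f x \<in> sphere 0 1"
  shows "regular_on X (\<lambda>x. translate u (f x))"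
  unfolding translate_def
  using assms by (intro regular_on_flip regular_on_stereo_add regular_on_const flip_in_sphere stereo_inv_in_sphere)
    (auto simp: addable_def)

text \<open>The translation vector is scaled from 0 to \<open>u\<close>. Every stage is defined
  because \<open>stereo_inv\<close> never takes the value \<open>far_pt\<close>.\<close>

lemma homotopic_on_translate:
  fixes f :: "'a::euclidean_space \<Rightarrow> real \<times> (real^'k)"
  assumes f: "f \<in> sphere_maps X"
  shows "(f, \<lambda>x. translate u (f x)) \<in> homotopic_on X"
proof (rule homotopic_onI)
  have "continuous_on ({0..1::real} \<times> X) (\<lambda>z. f (snd z))"
    by (rule continuous_on_compose2[OF sphere_mapsD(1)[OF f] continuous_on_snd[OF continuous_on_id]]) force
  moreover have S: "f (snd z) \<in> sphere 0 1" if "z \<in> {0..1::real} \<times> X" for z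
    using sphere_mapsD(2)[OF f, of "snd z"] that by auto
  ultimately show "continuous_on ({0..1::real} \<times> X) (\<lambda>z. translate (fst z *\<^sub>R u) (f (snd z)))"
    unfolding translate_def flip_def[of "stereo_add _ _"]
    by (intro continuous_on_Pair continuous_on_minus continuous_on_fst continuous_on_snd continuous_on_stereo_add
      continuous_on_stereo_inv) (auto simp: flip_def[abs_def] intro!: continuous_intros flip_in_sphere[unfolded flip_def] stereo_inv_in_sphere
      simp del: mem_sphere mem_sphere_0)
  show "translate (fst z *\<^sub>R u) (f (snd z)) \<in> sphere 0 1" if "z \<in> {0..1::real} \<times> X" for z
    by (rule translate_in_sphere[OF S[OF that]])
qed (simp_all add: translate_0 sphere_mapsD(2)[OF f] del: mem_sphere mem_sphere_0)

text \<open>A collision after translating by \<open>u\<close> and \<open>w\<close> determines (u, w)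
  as the pair of negated opposite coordinates at some point of \<open>X\<close>. These pairs form
  the image of a regular map from \<open>S\<close> to R^2k, which is negligible, so almost every (u,
  w) works.\<close>

lemma regular_addable_representatives:
  fixes f g :: "'a::euclidean_space \<Rightarrow> real \<times> (real^'k)"
  assumes f: "f \<in> sphere_maps X" "regular_on X f" and g: "g \<in> sphere_maps X" "regular_on X g"
    and low: "\<And>x. x \<in> X \<Longrightarrow> dim (zariski_tangent_space X x) < 2 * CARD('k::finite)"
  obtains f' g' where "(f, f') \<in> homotopic_on X" "(g, g') \<in> homotopic_on X" "addable X f' g'"
    "regular_on X f'" "regular_on X g'"
proof -
  \<comment> \<open>The points where both opposite coordinates are finite; no collision can occur
    elsewhere.\<close>
  define S where "S = {x \<in> X. f x \<noteq> (1, 0) \<and> g x \<noteq> (1, 0)}"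
  let ?v = "\<lambda>p :: real \<times> (real^'k). - (snd p /\<^sub>R (1 - fst p))"
  have "1 - fst (f x) \<noteq> 0 \<and> 1 - fst (g x) \<noteq> 0" if "x \<in> S" for x
    using that eq_base_pt_iff sphere_mapsD(2)[OF f(1)] sphere_mapsD(2)[OF g(1)] unfolding S_def by fastforce
  moreover have "regular_on S f" "regular_on S g"
    using f(2) g(2) regular_on_subset[of X _ S] by (auto simp: S_def)
  ultimately have "regular_on S (\<lambda>x. (?v (f x), ?v (g x)))"
    by (intro regular_on_intros) auto
  then have "negligible ((\<lambda>x. (?v (f x), ?v (g x))) ` S)"
    by (intro negligible_image_lowdim_tangent[of S X] regular_on_imp_differentiable_on)
      (use low in \<open>auto simp: S_def mult_2\<close>)
  then have "(\<lambda>x. (?v (f x), ?v (g x))) ` S \<noteq> UNIV"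
    using non_negligible_UNIV by metis
  then obtain u w where uw: "(u, w) \<notin> (\<lambda>x. (?v (f x), ?v (g x))) ` S"
    by auto
  show ?thesis
  proof (rule that[OF homotopic_on_translate[OF f(1), of u] homotopic_on_translate[OF g(1), of w]])
    show "addable X (\<lambda>x. translate u (f x)) (\<lambda>x. translate w (g x))"
      unfolding addable_def
    proof (intro ballI notI)
      fix x assume x: "x \<in> X" "translate u (f x) = far_pt \<and> translate w (g x) = far_pt"
      note translate_eq_far_pt[OF sphere_mapsD(2)[OF f(1) x(1)] x(2)[THEN conjunct1]]
        translate_eq_far_pt[OF sphere_mapsD(2)[OF g(1) x(1)] x(2)[THEN conjunct2]]
      with x(1) have "x \<in> S" "u = ?v (f x)" "w = ?v (g x)"
        unfolding S_def by blast+
      with uw show False by blast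
    qed
    show "regular_on X (\<lambda>x. translate u (f x))"
      by (rule regular_on_translate[OF f(2) sphere_mapsD(2)[OF f(1)]])
    show "regular_on X (\<lambda>x. translate w (g x))"
      by (rule regular_on_translate[OF g(2) sphere_mapsD(2)[OF g(1)]])
  qed
qed

section \<open>The cohomotopy group\<close>

text \<open>
  A self-map of the sphere, never antipodal to the identity and hence homotopic to it, which
  collapses the complement of the cap \<open>t < \<epsilon> - 1\<close> around the far point to the base point.
\<close>

definition stretch :: "real \<Rightarrow> real \<times> 'v::euclidean_space \<Rightarrow> real \<times> 'v" where
  "stretch \<epsilon> p = sgn (fst p + 1 - \<epsilon> / 2, max 0 (\<epsilon> - 1 - fst p) *\<^sub>R snd p)"

text \<open>The first component vanishes only at t = \<epsilon>/2 - 1, inside the cap, where the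
  vector part is scaled by \<epsilon>/2. A zero would therefore be a pole of the sphere, but this t
  is neither 1 nor -1.\<close>

lemma stretch_nonzero:
  fixes p :: "real \<times> 'v::euclidean_space"
  assumes "p \<in> sphere 0 1" "0 < \<epsilon>" "\<epsilon> \<le> 1"
  shows "(fst p + 1 - \<epsilon> / 2, max 0 (\<epsilon> - 1 - fst p) *\<^sub>R snd p) \<noteq> 0"
proof
  assume "(fst p + 1 - \<epsilon> / 2, max 0 (\<epsilon> - 1 - fst p) *\<^sub>R snd p) = 0"
  then have t: "fst p = \<epsilon> / 2 - 1" and "max 0 (\<epsilon> - 1 - fst p) *\<^sub>R snd p = 0"
    by (auto simp: zero_prod_def)
  then have "snd p = 0"
    using assms(2) by auto
  then have "\<bar>fst p\<bar> = 1"
    using assms(1) unfolding in_unit_sphere_iff by (simp add: power2_eq_1_iff abs_if) auto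
  with t assms(2,3) show False by auto
qed

lemma stretch_in_sphere:
  assumes "p \<in> sphere 0 1" "0 < \<epsilon>" "\<epsilon> \<le> 1"
  shows "stretch \<epsilon> p \<in> sphere 0 1"
  using stretch_nonzero[OF assms] by (simp add: stretch_def norm_sgn)

lemma stretch_eq_base_pt: "0 < \<epsilon> \<Longrightarrow> \<epsilon> - 1 \<le> fst p \<Longrightarrow> stretch \<epsilon> p = (1, 0)"
  by (simp add: stretch_def sgn_div_norm norm_Pair)

text \<open>The vector part is scaled by a nonnegative factor, so an antipodal value is possible
  only at the poles. There the unnormalized first component is 2 - \<epsilon>/2 or -\<epsilon>/2, of
  the same sign as t.\<close>

lemma stretch_not_antipodal:
  fixes p :: "real \<times> 'v::euclidean_space"
  assumes "p \<in> sphere 0 1" "0 < \<epsilon>" "\<epsilon> \<le> 1"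
  shows "p \<noteq> - stretch \<epsilon> p"
proof
  let ?w = "(fst p + 1 - \<epsilon> / 2, max 0 (\<epsilon> - 1 - fst p) *\<^sub>R snd p)"
  assume *: "p = - stretch \<epsilon> p"
  define r where "r = norm ?w"
  have r: "r > 0"
    using stretch_nonzero[OF assms] unfolding r_def zero_less_norm_iff .
  have "?w = r *\<^sub>R stretch \<epsilon> p"
    using r unfolding stretch_def sgn_div_norm r_def[symmetric] by simp
  also have "\<dots> = - (r *\<^sub>R p)"
    by (subst (2) *) simp
  finally have w: "?w = - (r *\<^sub>R p)" .
  then have 1: "fst p + 1 - \<epsilon> / 2 = - (r * fst p)"
    by (metis fst_conv fst_uminus fst_scaleR real_scaleR_def)
  have "max 0 (\<epsilon> - 1 - fst p) *\<^sub>R snd p = - (r *\<^sub>R snd p)"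
    using w by (metis snd_conv snd_uminus snd_scaleR)
  then have "(max 0 (\<epsilon> - 1 - fst p) + r) *\<^sub>R snd p = 0"
    by (simp add: scaleR_add_left)
  then have "snd p = 0"
    using r by (smt (verit) scaleR_eq_0_iff)
  then have "fst p = 1 \<or> fst p = -1"
    using assms(1) unfolding in_unit_sphere_iff by (simp add: power2_eq_1_iff)
  then show False
    using 1 r assms(2,3) by auto
qed

lemma continuous_on_stretch:
  assumes "f \<in> sphere_maps X" "0 < \<epsilon>" "\<epsilon> \<le> 1"
  shows "continuous_on X (\<lambda>x. stretch \<epsilon> (f x))"
  unfolding stretch_def
  using stretch_nonzero[OF sphere_mapsD(2)[OF assms(1)] assms(2,3)] sphere_mapsD(1)[OF assms(1)]
  by (intro continuous_on_sgn continuous_intros) auto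

lemma homotopic_on_stretch:
  assumes "f \<in> sphere_maps X" "0 < \<epsilon>" "\<epsilon> \<le> 1"
  shows "(f, \<lambda>x. stretch \<epsilon> (f x)) \<in> homotopic_on X"
proof (rule homotopic_on_slide(5)[OF assms(1)])
  show "(\<lambda>x. stretch \<epsilon> (f x)) \<in> sphere_maps X"
    by (intro sphere_mapsI continuous_on_stretch assms stretch_in_sphere sphere_mapsD(2)[OF assms(1)])
qed (rule stretch_not_antipodal[OF sphere_mapsD(2)[OF assms(1)] assms(2,3)])

text \<open>Addability and compactness keep the larger of the two first coordinates above -1 by a
  uniform margin. With \<epsilon> at most this margin, at every point \<open>stretch\<close> sends
  at least one of the two values to the base point.\<close>

lemma disjoint_supports:
  fixes f g :: "'a::euclidean_space \<Rightarrow> real \<times> (real^'k)"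
  assumes X: "compact X" and f: "f \<in> sphere_maps X" and g: "g \<in> sphere_maps X" and "addable X f g"
  obtains f' g' where "(f, f') \<in> homotopic_on X" "(g, g') \<in> homotopic_on X" "supp_on X f' \<inter> supp_on X g' = {}"
proof -
  let ?m = "\<lambda>x. max (fst (f x)) (fst (g x))"
  have m: "continuous_on X ?m"
    by (intro continuous_intros sphere_mapsD f g)
  have gt: "?m x > -1" if "x \<in> X" for x
    using addableD[OF assms(4) that] eq_far_pt_iff[OF sphere_mapsD(2)[OF f that]] eq_far_pt_iff[OF sphere_mapsD(2)[OF g that]]
      fst_bounds[OF sphere_mapsD(2)[OF f that]] fst_bounds[OF sphere_mapsD(2)[OF g that]] by (auto simp: less_max_iff_disj)
  obtain \<epsilon> where \<epsilon>: "0 < \<epsilon>" "\<epsilon> \<le> 1" "\<And>x. x \<in> X \<Longrightarrow> \<epsilon> - 1 \<le> ?m x"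
  proof (cases "X = {}")
    case True
    then show ?thesis using that[of 1] by simp
  next
    case False
    then obtain x where x: "x \<in> X" "\<forall>y\<in>X. ?m x \<le> ?m y"
      using continuous_attains_inf[OF X False m] by blast
    show ?thesis
      by (rule that[of "min 1 (?m x + 1)"]) (use x gt in \<open>fastforce+\<close>)
  qed
  show ?thesis
  proof (rule that[OF homotopic_on_stretch[OF f \<epsilon>(1,2)] homotopic_on_stretch[OF g \<epsilon>(1,2)]])
    have "stretch \<epsilon> (f x) = (1, 0) \<or> stretch \<epsilon> (g x) = (1, 0)" if "x \<in> X" for x
      using \<epsilon>(3)[OF that] stretch_eq_base_pt[OF \<epsilon>(1)] by (metis max_def)
    then show "supp_on X (\<lambda>x. stretch \<epsilon> (f x)) \<inter> supp_on X (\<lambda>x. stretch \<epsilon> (g x)) = {}"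
      unfolding supp_on_def by auto
  qed
qed

lemma disjoint_supports_addable:
  assumes "supp_on X f \<inter> supp_on X g = {}"
  shows "addable X f g"
  unfolding addable_def
proof (intro ballI notI)
  fix x assume "x \<in> X" "f x = far_pt \<and> g x = far_pt"
  then have "x \<in> supp_on X f \<inter> supp_on X g"
    by (auto simp: supp_on_def)
  with assms show False by blast
qed

lemma glue_eq_pointwise_add:
  assumes "f \<in> sphere_maps X" "g \<in> sphere_maps X" "supp_on X f \<inter> supp_on X g = {}" "x \<in> X"
  shows "glue X f g x = pointwise_add f g x"
proof -
  have "f x = (1, 0) \<or> g x = (1, 0)"
    using assms(3,4) by (auto simp: supp_on_def)
  then show ?thesis
    using assms(4) sphere_mapsD(2)[OF assms(1,4)] sphere_mapsD(2)[OF assms(2,4)]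
    unfolding glue_def pointwise_add_def supp_on_def
    by (auto simp: stereo_add_base_pt_left stereo_add_base_pt_right simp del: mem_sphere_0)
qed

lemma homotopic_on_const:
  "((\<lambda>x. far_pt, \<lambda>x. (1, 0)) :: ('a::euclidean_space, 'k::finite) sphere_map \<times> _) \<in> homotopic_on X"
proof -
  have "path_connected (sphere (0 :: real \<times> (real^'k)) 1)"
    by (rule path_connected_sphere) (simp add: Suc_leI)
  then have "path_component (sphere 0 1) far_pt ((1, 0) :: real \<times> (real^'k))"
    unfolding path_connected_component by (simp add: norm_Pair)
  then show ?thesis
    unfolding homotopic_on_def by (simp add: homotopic_constant_maps)
qed

text \<open>The sum takes values with negative first coordinate, hence never antipodal to
  \<open>far_pt\<close>, and slides to that constant. Connectedness of the sphere then moves the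
  constant to the base point.\<close>

lemma pointwise_add_flip_homotopic:
  fixes f :: "('a::euclidean_space, 'k::finite) sphere_map"
  assumes f: "f \<in> sphere_maps X"
  shows "(\<lambda>x. flip (f x)) \<in> sphere_maps X" "addable X (\<lambda>x. flip (f x)) f"
    "(pointwise_add (\<lambda>x. flip (f x)) f, \<lambda>x. (1, 0)) \<in> homotopic_on X"
proof -
  show m: "(\<lambda>x. flip (f x)) \<in> sphere_maps X"
    using sphere_mapsD[OF f] by (intro sphere_mapsI flip_in_sphere) (auto simp: flip_def intro!: continuous_intros)
  show ad: "addable X (\<lambda>x. flip (f x)) f"
    by (auto simp: addable_def flip_def)
  have "(pointwise_add (\<lambda>x. flip (f x)) f, \<lambda>x. far_pt) \<in> homotopic_on X"
  proof (rule homotopic_on_slide(5)[OF pointwise_add_in_sphere_maps[OF m f ad]])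
    show "(\<lambda>x. far_pt) \<in> sphere_maps X"
      by (rule sphere_mapsI) (auto simp: norm_Pair)
    fix x assume "x \<in> X"
    then have "fst (pointwise_add (\<lambda>x. flip (f x)) f x) < 0"
      unfolding pointwise_add_def by (intro fst_stereo_add_flip sphere_mapsD(2)[OF f])
    then show "pointwise_add (\<lambda>x. flip (f x)) f x \<noteq> - far_pt"
      by auto
  qed
  then show "(pointwise_add (\<lambda>x. flip (f x)) f, \<lambda>x. (1, 0)) \<in> homotopic_on X"
    using homotopic_on_const homotopic_on_trans by blast
qed

lemma base_in_sphere_maps: "(\<lambda>x. (1, 0)) \<in> sphere_maps X"
  by (rule sphere_mapsI) (auto simp: norm_Pair)

section \<open>General position for maps and homotopies\<close>

context
  fixes X :: "'a::euclidean_space set"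
  assumes compact: "compact X"
    and low: "\<And>x. x \<in> X \<Longrightarrow> Suc (dim (zariski_tangent_space X x)) < 2 * CARD('k::finite)"
begin

text \<open>After polynomial approximation and normalization, a collision at infinity requires both
  R^k-components to vanish. As a pair they map the cylinder onto a negligible subset of R^2k, since
  its tangent spaces have dimension below 2k; subtracting a small vector \<open>c\<close> outside
  this image prevents collisions.\<close>

lemma approx_addable:
  fixes F G :: "real \<times> 'a \<Rightarrow> real \<times> (real^'k)"
  assumes F: "continuous_on ({0..1} \<times> X) F" "\<And>z. z \<in> {0..1} \<times> X \<Longrightarrow> F z \<in> sphere 0 1"
    and G: "continuous_on ({0..1} \<times> X) G" "\<And>z. z \<in> {0..1} \<times> X \<Longrightarrow> G z \<in> sphere 0 1"
    and "\<delta> > 0"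
  obtains F' G' :: "real \<times> 'a \<Rightarrow> real \<times> (real^'k)"
  where "continuous_on ({0..1} \<times> X) F'" "\<And>z. z \<in> {0..1} \<times> X \<Longrightarrow> F' z \<in> sphere 0 1"
    "continuous_on ({0..1} \<times> X) G'" "\<And>z. z \<in> {0..1} \<times> X \<Longrightarrow> G' z \<in> sphere 0 1"
    "\<And>z. z \<in> {0..1} \<times> X \<Longrightarrow> dist (F z) (F' z) < \<delta>" "\<And>z. z \<in> {0..1} \<times> X \<Longrightarrow> dist (G z) (G' z) < \<delta>"
    "addable ({0..1} \<times> X) F' G'"
proof -
  let ?K = "{0..1::real} \<times> X"
  \<comment> \<open>Approximation and translation cost \<open>d\<close> each, and normalization
    doubles the total to 4d < \<delta>. The bound 2d < 1 keeps the vectors to be normalized away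
    from 0.\<close>
  define d where "d = min \<delta> 1 / 8"
  have d: "d > 0" "4 * d < \<delta>" "2 * d < 1"
    using assms(5) by (auto simp: d_def min_def)
  have K: "compact ?K"
    by (intro compact_Times compact) simp
  obtain P where P: "polynomial_function P" "\<And>z. z \<in> ?K \<Longrightarrow> norm (F z - P z) < d"
    using Stone_Weierstrass_polynomial_function[OF K F(1) d(1)] by blast
  obtain Q where Q: "polynomial_function Q" "\<And>z. z \<in> ?K \<Longrightarrow> norm (G z - Q z) < d"
    using Stone_Weierstrass_polynomial_function[OF K G(1) d(1)] by blast
  let ?\<phi> = "\<lambda>z. (snd (P z), snd (Q z))"
  have "negligible (?\<phi> ` ?K)"
  proof (rule negligible_image_lowdim_tangent)
    show "?K \<subseteq> UNIV \<times> X" by auto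
    show "dim (zariski_tangent_space (UNIV \<times> X) z) < DIM((real^'k) \<times> (real^'k))" if "z \<in> ?K" for z
      using dim_zariski_tangent_space_cylinder[of X z] low[of "snd z"] that by auto
    show "?\<phi> differentiable_on ?K"
      unfolding differentiable_on_def
    proof
      fix z
      obtain P' Q' where "(P has_derivative P') (at z within ?K)" "(Q has_derivative Q') (at z within ?K)"
        using differentiable_at_polynomial_function[OF P(1)] differentiable_at_polynomial_function[OF Q(1)]
        unfolding differentiable_def by blast
      then show "?\<phi> differentiable (at z within ?K)"
        using has_derivative_Pair[OF has_derivative_snd has_derivative_snd] unfolding differentiable_def by fast
    qed
  qed
  then have "\<not> ball 0 d \<subseteq> ?\<phi> ` ?K"
    using open_not_negligible[of "ball (0 :: (real^'k) \<times> (real^'k)) d"] d(1) negligible_subset by auto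
  then obtain c where c: "c \<in> ball 0 d" "c \<notin> ?\<phi> ` ?K" by blast
  define F' where "F' z = sgn (P z - (0, fst c))" for z
  define G' where "G' z = sgn (Q z - (0, snd c))" for z
  have nc: "norm (fst c) < d" "norm (snd c) < d"
    using c(1) norm_fst_le[of "fst c" "snd c"] norm_snd_le[of "snd c" "fst c"] by auto
  have close: "dist (R - (0, b)) p < 2 * d"
    if "norm (p - R) < d" "norm b < d" for p R :: "real \<times> (real^'k)" and b
  proof -
    have "dist (R - (0, b)) p = norm (p - R + (0, b))"
      by (simp add: dist_norm norm_minus_commute algebra_simps)
    also have "\<dots> \<le> norm (p - R) + norm ((0::real), b)"
      by (rule norm_triangle_ineq)
    finally show ?thesis
      using that by (simp add: norm_Pair)
  qed
  have FP: "dist (P z - (0, fst c)) (F z) < 2 * d" if "z \<in> ?K" for z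
    using close P(2)[OF that] nc by blast
  have GQ: "dist (Q z - (0, snd c)) (G z) < 2 * d" if "z \<in> ?K" for z
    using close Q(2)[OF that] nc by blast
  have nz: "P z - (0, fst c) \<noteq> 0" "Q z - (0, snd c) \<noteq> 0" if "z \<in> ?K" for z
    using FP[OF that] GQ[OF that] d(3) F(2)[OF that] G(2)[OF that] by (auto simp: dist_norm)
  have PQ: "continuous_on ?K P" "continuous_on ?K Q"
    using P(1) Q(1) by (auto intro: continuous_on_polymonial_function)
  show ?thesis
  proof (rule that)
    show "continuous_on ?K F'" "continuous_on ?K G'"
      unfolding F'_def G'_def using nz by (auto intro!: continuous_on_sgn continuous_intros PQ)
    show "F' z \<in> sphere 0 1" "G' z \<in> sphere 0 1" if "z \<in> ?K" for z
      using nz[OF that] by (auto simp: F'_def G'_def norm_sgn)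
    show "dist (F z) (F' z) < \<delta>" if "z \<in> ?K" for z
      using dist_sgn_le[of "F z" "P z - (0, fst c)"] FP[OF that] F(2)[OF that] d(2)
      by (simp add: F'_def dist_commute)
    show "dist (G z) (G' z) < \<delta>" if "z \<in> ?K" for z
      using dist_sgn_le[of "G z" "Q z - (0, snd c)"] GQ[OF that] G(2)[OF that] d(2)
      by (simp add: G'_def dist_commute)
    have snd0: "snd w = 0" if "sgn w = far_pt" "w \<noteq> 0" for w :: "real \<times> (real^'k)"
    proof -
      have "w = norm w *\<^sub>R sgn w"
        using that(2) by (simp add: sgn_div_norm)
      then show ?thesis
        using that(1) by (metis scaleR_zero_right snd_conv snd_scaleR)
    qed
    show "addable ?K F' G'"
      unfolding addable_def
    proof (intro ballI notI)
      fix z assume z: "z \<in> ?K" "F' z = far_pt \<and> G' z = far_pt"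
      then have "snd (P z) = fst c" "snd (Q z) = snd c"
        using snd0[of "P z - (0, fst c)"] snd0[of "Q z - (0, snd c)"] nz[OF z(1)] by (auto simp: F'_def G'_def)
      then have "?\<phi> z = c" by simp
      with c(2) z(1) show False by blast
    qed
  qed
qed

text \<open>Constant homotopies are perturbed and then restricted to time 0. Accuracy below 1 rules
  out antipodal values, so each approximation is homotopic to the original map.\<close>

lemma approx_addable_maps:
  fixes f g :: "'a \<Rightarrow> real \<times> (real^'k)"
  assumes f: "f \<in> sphere_maps X" and g: "g \<in> sphere_maps X" and "\<delta> > 0"
  obtains f' g' where "f' \<in> sphere_maps X" "g' \<in> sphere_maps X" "addable X f' g'"
    "\<And>x. x \<in> X \<Longrightarrow> dist (f x) (f' x) < \<delta>" "\<And>x. x \<in> X \<Longrightarrow> dist (g x) (g' x) < \<delta>"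
    "(f, f') \<in> homotopic_on X" "(g, g') \<in> homotopic_on X"
proof -
  let ?K = "{0..1::real} \<times> X"
  have c: "continuous_on ?K (\<lambda>z. h (snd z))" if "h \<in> sphere_maps X" for h :: "'a \<Rightarrow> real \<times> (real^'k)"
    by (rule continuous_on_compose2[OF sphere_mapsD(1)[OF that] continuous_on_snd[OF continuous_on_id]]) force
  have s: "h (snd z) \<in> sphere 0 1" if "h \<in> sphere_maps X" "z \<in> ?K" for h :: "'a \<Rightarrow> real \<times> (real^'k)" and z
    using sphere_mapsD(2)[OF that(1)] that(2) by auto
  obtain F' G' :: "real \<times> 'a \<Rightarrow> real \<times> (real^'k)"
  where FG: "continuous_on ?K F'" "\<And>z. z \<in> ?K \<Longrightarrow> F' z \<in> sphere 0 1"
    "continuous_on ?K G'" "\<And>z. z \<in> ?K \<Longrightarrow> G' z \<in> sphere 0 1"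
    "\<And>z. z \<in> ?K \<Longrightarrow> dist (f (snd z)) (F' z) < min \<delta> 1" "\<And>z. z \<in> ?K \<Longrightarrow> dist (g (snd z)) (G' z) < min \<delta> 1"
    "addable ?K F' G'"
    using approx_addable[OF c[OF f] s[OF f] c[OF g] s[OF g], of "min \<delta> 1"] assms(3) by auto
  have slice: "(\<lambda>x. H (0, x)) \<in> sphere_maps X"
    if "continuous_on ?K H" "\<And>z. z \<in> ?K \<Longrightarrow> H z \<in> sphere 0 1" for H :: "real \<times> 'a \<Rightarrow> real \<times> (real^'k)"
  proof (rule sphere_mapsI)
    show "continuous_on X (\<lambda>x. H (0, x))"
      by (rule continuous_on_compose2[OF that(1)]) (auto intro!: continuous_intros)
  qed (use that(2) in auto)
  have hom: "(h, h') \<in> homotopic_on X"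
    if "h \<in> sphere_maps X" "h' \<in> sphere_maps X" "\<And>x. x \<in> X \<Longrightarrow> dist (h x) (h' x) < 1" for h h' :: "'a \<Rightarrow> real \<times> (real^'k)"
  proof (rule homotopic_on_slide(5)[OF that(1,2)])
    fix x assume x: "x \<in> X"
    show "h x \<noteq> - h' x"
    proof
      assume "h x = - h' x"
      then have "h x - h' x = - (2 *\<^sub>R h' x)"
        by (simp add: scaleR_2)
      then show False
        using that(3)[OF x] sphere_mapsD(2)[OF that(2) x] by (simp add: dist_norm)
    qed
  qed
  show ?thesis
  proof (rule that[OF slice[OF FG(1,2)] slice[OF FG(3,4)]])
    show "addable X (\<lambda>x. F' (0, x)) (\<lambda>x. G' (0, x))"
      using addableD[OF FG(7)] by (auto simp: addable_def)
    show "dist (f x) (F' (0, x)) < \<delta>" "dist (g x) (G' (0, x)) < \<delta>" if "x \<in> X" for x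
      using FG(5,6)[of "(0, x)"] that by auto
    show "(f, \<lambda>x. F' (0, x)) \<in> homotopic_on X"
      by (rule hom[OF f slice[OF FG(1,2)]]) (use FG(5)[of "(0, _)"] in auto)
    show "(g, \<lambda>x. G' (0, x)) \<in> homotopic_on X"
      by (rule hom[OF g slice[OF FG(3,4)]]) (use FG(6)[of "(0, _)"] in auto)
  qed
qed

text \<open>The given homotopies may collide at infinity, so they are replaced by a nearby addable
  pair, whose pointwise sum is a homotopy. This moves the ends slightly, and
  \<open>addable_open\<close> connects them to the original sums.\<close>

lemma pointwise_add_well_defined:
  fixes f g f' g' :: "'a \<Rightarrow> real \<times> (real^'k)"
  assumes ff': "(f, f') \<in> homotopic_on X" and gg': "(g, g') \<in> homotopic_on X"
    and ad: "addable X f g" "addable X f' g'"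
  shows "(pointwise_add f g, pointwise_add f' g') \<in> homotopic_on X"
proof -
  let ?K = "{0..1::real} \<times> X"
  note maps = homotopic_on_imp_sphere_maps[OF ff'] homotopic_on_imp_sphere_maps[OF gg']
  obtain F where F: "continuous_on ?K F" "\<And>z. z \<in> ?K \<Longrightarrow> F z \<in> sphere 0 1"
    "\<And>x. x \<in> X \<Longrightarrow> F (0, x) = f x" "\<And>x. x \<in> X \<Longrightarrow> F (1, x) = f' x"
    using homotopic_onE[OF ff'] by blast
  obtain G where G: "continuous_on ?K G" "\<And>z. z \<in> ?K \<Longrightarrow> G z \<in> sphere 0 1"
    "\<And>x. x \<in> X \<Longrightarrow> G (0, x) = g x" "\<And>x. x \<in> X \<Longrightarrow> G (1, x) = g' x"
    using homotopic_onE[OF gg'] by blast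
  \<comment> \<open>Each end of the homotopy has its own tolerance; the perturbation respects the
    smaller one.\<close>
  obtain \<delta>0 where \<delta>0: "\<delta>0 > 0" "\<And>p q. p \<in> sphere_maps X \<Longrightarrow> q \<in> sphere_maps X \<Longrightarrow>
     (\<And>x. x \<in> X \<Longrightarrow> dist (f x) (p x) < \<delta>0) \<Longrightarrow> (\<And>x. x \<in> X \<Longrightarrow> dist (g x) (q x) < \<delta>0) \<Longrightarrow>
     addable X p q \<and> (pointwise_add f g, pointwise_add p q) \<in> homotopic_on X"
    using addable_open[OF compact maps(1,3) ad(1)] by metis
  obtain \<delta>1 where \<delta>1: "\<delta>1 > 0" "\<And>p q. p \<in> sphere_maps X \<Longrightarrow> q \<in> sphere_maps X \<Longrightarrow>
     (\<And>x. x \<in> X \<Longrightarrow> dist (f' x) (p x) < \<delta>1) \<Longrightarrow> (\<And>x. x \<in> X \<Longrightarrow> dist (g' x) (q x) < \<delta>1) \<Longrightarrow>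
     addable X p q \<and> (pointwise_add f' g', pointwise_add p q) \<in> homotopic_on X"
    using addable_open[OF compact maps(2,4) ad(2)] by metis
  obtain F' G' :: "real \<times> 'a \<Rightarrow> real \<times> (real^'k)"
  where FG: "continuous_on ?K F'" "\<And>z. z \<in> ?K \<Longrightarrow> F' z \<in> sphere 0 1"
    "continuous_on ?K G'" "\<And>z. z \<in> ?K \<Longrightarrow> G' z \<in> sphere 0 1"
    "\<And>z. z \<in> ?K \<Longrightarrow> dist (F z) (F' z) < min \<delta>0 \<delta>1" "\<And>z. z \<in> ?K \<Longrightarrow> dist (G z) (G' z) < min \<delta>0 \<delta>1"
    "addable ?K F' G'"
    using approx_addable[OF F(1,2) G(1,2), of "min \<delta>0 \<delta>1"] \<delta>0(1) \<delta>1(1) by auto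
  have slice: "(\<lambda>x. H (s, x)) \<in> sphere_maps X" if "s \<in> {0..1}"
    "continuous_on ?K H" "\<And>z. z \<in> ?K \<Longrightarrow> H z \<in> sphere 0 1" for s and H :: "real \<times> 'a \<Rightarrow> real \<times> (real^'k)"
  proof (rule sphere_mapsI)
    show "continuous_on X (\<lambda>x. H (s, x))"
      by (rule continuous_on_compose2[OF that(2)]) (use that(1) in \<open>auto intro!: continuous_intros\<close>)
  qed (use that(1,3) in auto)
  have "(pointwise_add f g, pointwise_add (\<lambda>x. F' (0, x)) (\<lambda>x. G' (0, x))) \<in> homotopic_on X"
    using FG(5,6)[of "(0, _)"] F(3) G(3) by (intro \<delta>0(2)[THEN conjunct2] slice[OF _ FG(1,2)] slice[OF _ FG(3,4)]) auto
  moreover have "(pointwise_add f' g', pointwise_add (\<lambda>x. F' (1, x)) (\<lambda>x. G' (1, x))) \<in> homotopic_on X"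
    using FG(5,6)[of "(1, _)"] F(4) G(4) by (intro \<delta>1(2)[THEN conjunct2] slice[OF _ FG(1,2)] slice[OF _ FG(3,4)]) auto
  moreover note pointwise_add_homotopic[OF FG(1-4,7)]
  ultimately show ?thesis
    by (meson homotopic_on_trans homotopic_on_sym)
qed

text \<open>Evaluates the definite description. A disjoint pair of representatives exists by
  \<open>disjoint_supports\<close>, and every such pair gives the same class, because its glued map
  is its pointwise sum.\<close>

lemma cohomotopy_add_homotopy_class:
  fixes f g :: "'a \<Rightarrow> real \<times> (real^'k)"
  assumes f: "f \<in> sphere_maps X" and g: "g \<in> sphere_maps X" and "addable X f g"
  shows "cohomotopy_add X (homotopy_class X f) (homotopy_class X g) = homotopy_class X (pointwise_add f g)"
proof -
  have val: "homotopy_class X (glue X f' g') = homotopy_class X (pointwise_add f g)"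
    if "(f, f') \<in> homotopic_on X" "(g, g') \<in> homotopic_on X" "supp_on X f' \<inter> supp_on X g' = {}" for f' g'
  proof -
    note ad = disjoint_supports_addable[OF that(3)]
    have maps: "f' \<in> sphere_maps X" "g' \<in> sphere_maps X"
      using that homotopic_on_imp_sphere_maps by blast+
    have "(pointwise_add f' g', glue X f' g') \<in> homotopic_on X"
      using pointwise_add_in_sphere_maps[OF maps ad] glue_eq_pointwise_add[OF maps that(3)]
      by (intro homotopic_on_eq) simp_all
    then have "(pointwise_add f g, glue X f' g') \<in> homotopic_on X"
      using pointwise_add_well_defined[OF that(1,2) assms(3) ad] homotopic_on_trans by blast
    then show ?thesis
      using homotopy_class_eq_iff homotopic_on_imp_sphere_maps homotopic_on_sym by metis
  qed
  obtain f' g' where fg: "(f, f') \<in> homotopic_on X" "(g, g') \<in> homotopic_on X" "supp_on X f' \<inter> supp_on X g' = {}"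
    using disjoint_supports[OF compact f g assms(3)] by blast
  show ?thesis
    unfolding cohomotopy_add_def
  proof (rule the_equality)
    show "\<exists>p\<in>homotopy_class X f. \<exists>q\<in>homotopy_class X g. supp_on X p \<inter> supp_on X q = {} \<and>
        homotopy_class X (pointwise_add f g) = homotopy_class X (glue X p q)"
      using fg val[OF fg] by (metis mem_homotopy_class_iff)
  qed (use val in \<open>auto simp: mem_homotopy_class_iff\<close>)
qed

section \<open>Group laws and the algebraic subgroup\<close>

lemma addable_representatives:
  fixes \<alpha> \<beta> :: "('a, 'k) sphere_map set"
  assumes "\<alpha> \<in> cohomotopy X" "\<beta> \<in> cohomotopy X"
  obtains f g where "f \<in> sphere_maps X" "g \<in> sphere_maps X" "addable X f g"
    "\<alpha> = homotopy_class X f" "\<beta> = homotopy_class X g"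
proof -
  obtain f g where f: "f \<in> sphere_maps X" "\<alpha> = homotopy_class X f" and g: "g \<in> sphere_maps X" "\<beta> = homotopy_class X g"
    using assms cohomotopy_cases by metis
  obtain f' g' where "f' \<in> sphere_maps X" "g' \<in> sphere_maps X" "addable X f' g'"
    "(f, f') \<in> homotopic_on X" "(g, g') \<in> homotopic_on X"
    using approx_addable_maps[OF f(1) g(1) zero_less_one] by metis
  then show ?thesis
    using that f g homotopy_class_eq_iff by metis
qed

text \<open>The pairs are made addable in the order (f, g), (f, h), (g, h). Each perturbation is
  small enough for \<open>addable_open\<close> to preserve the pairs already treated.\<close>

lemma addable_representatives3:
  fixes \<alpha> \<beta> \<gamma> :: "('a, 'k) sphere_map set"
  assumes "\<alpha> \<in> cohomotopy X" "\<beta> \<in> cohomotopy X" "\<gamma> \<in> cohomotopy X"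
  obtains f g h where "f \<in> sphere_maps X" "g \<in> sphere_maps X" "h \<in> sphere_maps X"
    "addable X f g" "addable X f h" "addable X g h"
    "\<alpha> = homotopy_class X f" "\<beta> = homotopy_class X g" "\<gamma> = homotopy_class X h"
proof -
  obtain f1 g1 where 1: "f1 \<in> sphere_maps X" "g1 \<in> sphere_maps X" "addable X f1 g1"
    "\<alpha> = homotopy_class X f1" "\<beta> = homotopy_class X g1"
    using addable_representatives[OF assms(1,2)] by metis
  obtain h where h: "h \<in> sphere_maps X" "\<gamma> = homotopy_class X h"
    using assms(3) cohomotopy_cases by metis
  obtain \<delta>1 where \<delta>1: "\<delta>1 > 0" "\<And>p q. p \<in> sphere_maps X \<Longrightarrow> q \<in> sphere_maps X \<Longrightarrow>
     (\<And>x. x \<in> X \<Longrightarrow> dist (f1 x) (p x) < \<delta>1) \<Longrightarrow> (\<And>x. x \<in> X \<Longrightarrow> dist (g1 x) (q x) < \<delta>1) \<Longrightarrow> addable X p q"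
    using addable_open[OF compact 1(1-3)] by metis
  obtain f2 h2 where 2: "f2 \<in> sphere_maps X" "h2 \<in> sphere_maps X" "addable X f2 h2"
    "\<And>x. x \<in> X \<Longrightarrow> dist (f1 x) (f2 x) < \<delta>1" "(f1, f2) \<in> homotopic_on X" "(h, h2) \<in> homotopic_on X"
    using approx_addable_maps[OF 1(1) h(1) \<delta>1(1)] by metis
  have f2g1: "addable X f2 g1"
    by (rule \<delta>1(2)[OF 2(1) 1(2) 2(4)]) (simp_all add: \<delta>1(1))
  obtain \<delta>2 where \<delta>2: "\<delta>2 > 0" "\<And>p q. p \<in> sphere_maps X \<Longrightarrow> q \<in> sphere_maps X \<Longrightarrow>
     (\<And>x. x \<in> X \<Longrightarrow> dist (f2 x) (p x) < \<delta>2) \<Longrightarrow> (\<And>x. x \<in> X \<Longrightarrow> dist (h2 x) (q x) < \<delta>2) \<Longrightarrow> addable X p q"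
    using addable_open[OF compact 2(1-3)] by metis
  obtain \<delta>3 where \<delta>3: "\<delta>3 > 0" "\<And>p q. p \<in> sphere_maps X \<Longrightarrow> q \<in> sphere_maps X \<Longrightarrow>
     (\<And>x. x \<in> X \<Longrightarrow> dist (f2 x) (p x) < \<delta>3) \<Longrightarrow> (\<And>x. x \<in> X \<Longrightarrow> dist (g1 x) (q x) < \<delta>3) \<Longrightarrow> addable X p q"
    using addable_open[OF compact 2(1) 1(2) f2g1] by metis
  \<comment> \<open>In the last perturbation \<delta>2 protects the pair of \<open>f2\<close> with
    the third map and \<delta>3 its pair with the second.\<close>
  have "min \<delta>2 \<delta>3 > 0"
    using \<delta>2(1) \<delta>3(1) by simp
  then obtain g3 h3 where 3: "g3 \<in> sphere_maps X" "h3 \<in> sphere_maps X" "addable X g3 h3"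
    "\<And>x. x \<in> X \<Longrightarrow> dist (g1 x) (g3 x) < min \<delta>2 \<delta>3" "\<And>x. x \<in> X \<Longrightarrow> dist (h2 x) (h3 x) < min \<delta>2 \<delta>3"
    "(g1, g3) \<in> homotopic_on X" "(h2, h3) \<in> homotopic_on X"
    using approx_addable_maps[OF 1(2) 2(2)] by metis
  have f2g3: "addable X f2 g3"
    by (rule \<delta>3(2)[OF 2(1) 3(1)]) (use \<delta>3(1) 3(4) in auto)
  have f2h3: "addable X f2 h3"
    by (rule \<delta>2(2)[OF 2(1) 3(2)]) (use \<delta>2(1) 3(5) in auto)
  have "\<alpha> = homotopy_class X f2" "\<beta> = homotopy_class X g3" "\<gamma> = homotopy_class X h3"
    using 1 2 3 h homotopy_class_eq_iff homotopic_on_trans by metis+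
  then show ?thesis
    using that 2(1) 3(1-3) f2g3 f2h3 by blast
qed

text \<open>With representatives in general position the laws hold pointwise, except that inverses
  need the homotopy for \<open>flip\<close>. A left unit and left inverses suffice.\<close>

lemma group_cohomotopy_group: "group (cohomotopy_group X :: ('a, 'k) sphere_map set monoid)"
proof (rule groupI)
  let ?G = "cohomotopy_group X :: ('a, 'k) sphere_map set monoid"
  note sum = cohomotopy_add_homotopy_class
  have car: "carrier ?G = cohomotopy X" and mult: "x \<otimes>\<^bsub>?G\<^esub> y = cohomotopy_add X x y"
    and one: "\<one>\<^bsub>?G\<^esub> = homotopy_class X (\<lambda>_. (1, 0))" for x y
    by (simp_all add: cohomotopy_group_def)
  show "x \<otimes>\<^bsub>?G\<^esub> y \<in> carrier ?G" if xy: "x \<in> carrier ?G" "y \<in> carrier ?G" for x y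
  proof -
    obtain f g where "f \<in> sphere_maps X" "g \<in> sphere_maps X" "addable X f g"
      "x = homotopy_class X f" "y = homotopy_class X g"
      using addable_representatives[OF xy[unfolded car]] by metis
    then show ?thesis
      unfolding car mult by (simp add: sum homotopy_class_in_cohomotopy pointwise_add_in_sphere_maps)
  qed
  show "\<one>\<^bsub>?G\<^esub> \<in> carrier ?G"
    unfolding car one by (intro homotopy_class_in_cohomotopy base_in_sphere_maps)
  show "x \<otimes>\<^bsub>?G\<^esub> y \<otimes>\<^bsub>?G\<^esub> z = x \<otimes>\<^bsub>?G\<^esub> (y \<otimes>\<^bsub>?G\<^esub> z)"
    if xyz: "x \<in> carrier ?G" "y \<in> carrier ?G" "z \<in> carrier ?G" for x y z
  proof -
    obtain f g h where fgh: "f \<in> sphere_maps X" "g \<in> sphere_maps X" "h \<in> sphere_maps X"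
      and ad: "addable X f g" "addable X f h" "addable X g h"
      and eq: "x = homotopy_class X f" "y = homotopy_class X g" "z = homotopy_class X h"
      using addable_representatives3[OF xyz[unfolded car]] by metis
    note maps = pointwise_add_in_sphere_maps[OF fgh(1,2) ad(1)] pointwise_add_in_sphere_maps[OF fgh(2,3) ad(3)]
    \<comment> \<open>A sum is at infinity only where one of its summands is, so pairwise addability
      passes to the iterated sums.\<close>
    have ad': "addable X (pointwise_add f g) h" "addable X f (pointwise_add g h)"
      using ad fgh[THEN sphere_mapsD(2)] stereo_add_eq_far_pt_iff unfolding addable_def pointwise_add_def by metis+
    have "(pointwise_add (pointwise_add f g) h, pointwise_add f (pointwise_add g h)) \<in> homotopic_on X"
    proof (rule homotopic_on_eq[OF pointwise_add_in_sphere_maps[OF maps(1) fgh(3) ad'(1)]])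
      show "pointwise_add (pointwise_add f g) h x = pointwise_add f (pointwise_add g h) x" if "x \<in> X" for x
        unfolding pointwise_add_def
        by (intro stereo_add_assoc sphere_mapsD(2)[OF fgh(1) that] sphere_mapsD(2)[OF fgh(2) that]
          sphere_mapsD(2)[OF fgh(3) that] addableD[OF ad(1) that] addableD[OF ad(2) that] addableD[OF ad(3) that])
    qed
    then show ?thesis
      unfolding mult eq by (simp add: sum fgh ad ad' maps homotopy_class_eq_iff pointwise_add_in_sphere_maps)
  qed
  show "\<one>\<^bsub>?G\<^esub> \<otimes>\<^bsub>?G\<^esub> x = x" if x: "x \<in> carrier ?G" for x
  proof -
    obtain f where f: "f \<in> sphere_maps X" "x = homotopy_class X f"
      using cohomotopy_cases[OF x[unfolded car]] by metis
    have ad: "addable X (\<lambda>x. (1, 0)) f"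
      by (simp add: addable_def)
    have "(pointwise_add (\<lambda>x. (1, 0)) f, f) \<in> homotopic_on X"
    proof (rule homotopic_on_eq[OF pointwise_add_in_sphere_maps[OF base_in_sphere_maps f(1) ad]])
      show "pointwise_add (\<lambda>x. (1, 0)) f x = f x" if "x \<in> X" for x
        unfolding pointwise_add_def by (rule stereo_add_base_pt_left[OF sphere_mapsD(2)[OF f(1) that]])
    qed
    then show ?thesis
      unfolding one mult f(2) sum[OF base_in_sphere_maps f(1) ad]
      by (subst homotopy_class_eq_iff) (use homotopic_on_imp_sphere_maps in blast)+
  qed
  show "\<exists>y\<in>carrier ?G. y \<otimes>\<^bsub>?G\<^esub> x = \<one>\<^bsub>?G\<^esub>" if x: "x \<in> carrier ?G" for x
  proof -
    obtain f where f: "f \<in> sphere_maps X" "x = homotopy_class X f"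
      using cohomotopy_cases[OF x[unfolded car]] by metis
    note inv = pointwise_add_flip_homotopic[OF f(1)]
    show ?thesis
      unfolding car mult one f(2)
    proof
      show "cohomotopy_add X (homotopy_class X (\<lambda>x. flip (f x))) (homotopy_class X f) = homotopy_class X (\<lambda>_. (1, 0))"
        unfolding sum[OF inv(1) f(1) inv(2)]
        by (subst homotopy_class_eq_iff) (use homotopic_on_imp_sphere_maps inv(3) in blast)+
    qed (rule homotopy_class_in_cohomotopy[OF inv(1)])
  qed
qed

text \<open>Regular representatives can be made addable while staying regular, and their pointwise
  sum is then regular, its denominator having no zeros. The inverse class is represented by the
  reflected map, again regular.\<close>

lemma subgroup_algebraic_cohomotopy:
  "subgroup (algebraic_cohomotopy X) (cohomotopy_group X :: ('a, 'k) sphere_map set monoid)"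
proof
  let ?G = "cohomotopy_group X :: ('a, 'k) sphere_map set monoid"
  note sum = cohomotopy_add_homotopy_class
  have car: "carrier ?G = cohomotopy X" and mult: "x \<otimes>\<^bsub>?G\<^esub> y = cohomotopy_add X x y"
    and one: "\<one>\<^bsub>?G\<^esub> = homotopy_class X (\<lambda>_. (1, 0))" for x y
    by (simp_all add: cohomotopy_group_def)
  have algI: "homotopy_class X f \<in> algebraic_cohomotopy X"
    if "f \<in> sphere_maps X" "regular_on X f" for f :: "('a, 'k) sphere_map"
  proof -
    have "f \<in> homotopy_class X f"
      using homotopic_on_refl[OF that(1)] by (simp add: mem_homotopy_class_iff)
    moreover have "regular_map X (sphere 0 1) f"
      using that by (simp add: regular_map_iff sphere_maps_def)
    ultimately show ?thesis
      unfolding algebraic_cohomotopy_def using homotopy_class_in_cohomotopy[OF that(1)] by blast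
  qed
  have algE: "\<exists>f. f \<in> sphere_maps X \<and> regular_on X f \<and> x = homotopy_class X f"
    if xa: "x \<in> algebraic_cohomotopy X" for x :: "('a, 'k) sphere_map set"
  proof -
    obtain f where f: "x \<in> cohomotopy X" "f \<in> x" "regular_on X f"
      using xa unfolding algebraic_cohomotopy_def regular_map_iff by blast
    obtain g where g: "g \<in> sphere_maps X" "x = homotopy_class X g"
      using cohomotopy_cases[OF f(1)] by metis
    then have "(g, f) \<in> homotopic_on X"
      using f(2) by (simp add: mem_homotopy_class_iff)
    then show ?thesis
      using f(3) g homotopic_on_imp_sphere_maps homotopy_class_eq_iff by metis
  qed
  show "algebraic_cohomotopy X \<subseteq> carrier ?G"
    unfolding car algebraic_cohomotopy_def by blast
  show "\<one>\<^bsub>?G\<^esub> \<in> algebraic_cohomotopy X"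
    unfolding one by (intro algI base_in_sphere_maps regular_on_const)
  show "x \<otimes>\<^bsub>?G\<^esub> y \<in> algebraic_cohomotopy X"
    if xy: "x \<in> algebraic_cohomotopy X" "y \<in> algebraic_cohomotopy X" for x y
  proof -
    obtain f g where f: "f \<in> sphere_maps X" "regular_on X f" "x = homotopy_class X f"
      and g: "g \<in> sphere_maps X" "regular_on X g" "y = homotopy_class X g"
      using algE xy by metis
    obtain f' g' where hom: "(f, f') \<in> homotopic_on X" "(g, g') \<in> homotopic_on X"
      and ad: "addable X f' g'" and reg: "regular_on X f'" "regular_on X g'"
      using regular_addable_representatives[OF f(1,2) g(1,2)] low Suc_lessD by metis
    have maps: "f' \<in> sphere_maps X" "g' \<in> sphere_maps X"
      using hom homotopic_on_imp_sphere_maps by blast+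
    have "x = homotopy_class X f'" "y = homotopy_class X g'"
      using hom f g maps homotopy_class_eq_iff by metis+
    moreover have "regular_on X (pointwise_add f' g')"
      unfolding pointwise_add_def
      by (rule regular_on_stereo_add[OF reg sphere_mapsD(2)[OF maps(1)] sphere_mapsD(2)[OF maps(2)] ad])
    ultimately show ?thesis
      unfolding mult by (simp add: sum maps ad algI pointwise_add_in_sphere_maps)
  qed
  show "inv\<^bsub>?G\<^esub> x \<in> algebraic_cohomotopy X" if x: "x \<in> algebraic_cohomotopy X" for x
  proof -
    obtain f where f: "f \<in> sphere_maps X" "regular_on X f" "x = homotopy_class X f"
      using algE x by metis
    note inv = pointwise_add_flip_homotopic[OF f(1)]
    let ?y = "homotopy_class X (\<lambda>x. flip (f x))"
    have "?y \<otimes>\<^bsub>?G\<^esub> x = \<one>\<^bsub>?G\<^esub>"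
      unfolding mult one f(3) sum[OF inv(1) f(1) inv(2)]
      by (subst homotopy_class_eq_iff) (use homotopic_on_imp_sphere_maps inv(3) in blast)+
    then have "inv\<^bsub>?G\<^esub> x = ?y"
      using group.inv_equality[OF group_cohomotopy_group] homotopy_class_in_cohomotopy f(1,3) inv(1) car by metis
    then show ?thesis
      using algI[OF inv(1) regular_on_flip[OF f(2)]] by simp
  qed
qed

end

theorem theorem1p2:
  fixes X :: "(real^'a) set"
  assumes "algebraic_set X"
    and "nonsingular X"
    and "compact X"
    and "alg_dim X \<le> enat (2 * CARD('k::finite) - 2)"
  shows "group (cohomotopy_group X :: (real^'a, 'k) sphere_map set monoid) \<and>
    subgroup (algebraic_cohomotopy X) (cohomotopy_group X :: (real^'a, 'k) sphere_map set monoid)"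
proof -
  have "Suc (dim (zariski_tangent_space X x)) < 2 * CARD('k)" if "x \<in> X" for x
  proof -
    have "enat (dim (zariski_tangent_space X x)) \<le> enat (2 * CARD('k) - 2)"
      using dim_zariski_tangent_space_le_alg_dim[OF assms(2) that] assms(4) by (rule order_trans)
    moreover have "CARD('k) > 0"
      by simp
    \<comment> \<open>Positivity of k makes the natural number subtraction in 2k - 2 exact, leaving
      room for the homotopy parameter.\<close>
    ultimately show ?thesis
      unfolding enat_ord_simps by linarith
  qed
  then show ?thesis
    using group_cohomotopy_group[OF assms(3)] subgroup_algebraic_cohomotopy[OF assms(3)] by blast
qed

end
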